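(* In the setting described in the context (plant with $m$ independent lossy actuation channels, horizon $N$, information sets $\mathcal F_k$ (TCP-like) and $\mathcal G_k$ (UDP-like), and optimal cost $J^*(\mathcal I_k)$, $\mathcal I_k\in\{\mathcal F_k,\mathcal G_k\}$), put $$\mathbf G(\mathcal F_k)=\Omega_g\overline\Upsilon+\Psi,\qquad \mathbf G(\mathcal G_k)=\Psi+(\mathbf I\odot\Omega_g)(\mathbf I-\overline\Upsilon)+\Omega_g\overline\Upsilon .$$ Then the optimal cost for the TCP-like protocol is $$J^*(\mathcal F_k)=X_k^{\sf T}(\mathbf Q+\Omega_p)X_k+\operatorname{tr}(\Sigma_{\mathcal W}\Omega_l)-X_k^{\sf T}\Omega_{gp}^{\sf T}\,\overline\Upsilon\,\mathbf G(\mathcal F_k)^{-1}\Omega_{gp}X_k,$$ and the optimal cost for the UDP-like protocol is $$J^*(\mathcal G_k)=X_k^{\sf T}(\mathbf Q+\Omega_p)X_k+\operatorname{tr}(\Sigma_{\mathcal W}\Omega_l)-X_k^{\sf T}\Omega_{gp}^{\sf T}\,\overline\Upsilon\,\mathbf G(\mathcal G_k)^{-1}\Omega_{gp}X_k .$$ The corresponding optimal control laws (minimisers) are $$\mathcal U_k^*(\mathcal F_k)=-\mathbf G(\mathcal F_k)^{-1}\Omega_{gp}X_k,\qquad \mathcal U_k^*(\mathcal G_k)=-\mathbf G(\mathcal G_k)^{-1}\Omega_{gp}X_k .$$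
   Context: Plant: $X_{k+1}=\mathbf A X_k+\mathbf B\mathbf V_kU_k+W_k$ with $\mathbf A\in\mathbb R^{n\times n}$, $\mathbf B\in\mathbb R^{n\times m}$. The noise $W_k\in\mathbb R^n$ is Gaussian with mean $0$ and positive definite covariance $\Sigma_W$, independent over time. $\mathbf V_k$ is a diagonal $m\times m$ random matrix whose diagonal entries are Bernoulli, the $i$-th with mean $\mu_i$; all these Bernoulli variables are independent over $i$ and $k$ and independent of the noise. $\mathbb E[\mathbf V_k]=\mathbf M=\operatorname{diag}(\mu_1,\dots,\mu_m)$, $\mu_i\in[0,1]$, $\mathbf M$ positive definite. The state $X_k$ is Gaussian with positive definite covariance and is known to the controller at time $k$. Information sets: TCP-like $\mathcal F_k=\{X_0,\dots,X_k,\mathbf V_0,\dots,\mathbf V_{k-1}\}$; UDP-like $\mathcal G_k=\{X_0,\dots,X_k\}$; $\mathcal I_k$ denotes either. Over a horizon $N\ge1$ the dynamics are stacked as $\mathcal X_k=\Phi X_k+\Gamma\Upsilon_k\mathcal U_k(\mathcal I_k)+\Lambda\mathcal W_k$, where $\mathcal X_k=(X_{k+1},\dots,X_{k+N})$, $\mathcal W_k=(W_k,\dots,W_{k+N-1})$ with block-diagonal covariance $\Sigma_{\mathcal W}=\mathbf I_N\otimes\Sigma_W$, $\Upsilon_k=\operatorname{blockdiag}(\mathbf V_k,\dots,\mathbf V_{k+N-1})$, $\overline\Upsilon=\mathbb E[\Upsilon_k]=\mathbf I_N\otimes\mathbf M$, $\Phi$ is the block column $(\mathbf A,\mathbf A^2,\dots,\mathbf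 A^N)$, $\Gamma$ is block lower triangular with $(i,j)$ block $\mathbf A^{i-j}\mathbf B$ for $i\ge j$, and $\Lambda$ is block lower triangular with $(i,j)$ block $\mathbf A^{i-j}$ for $i\ge j$. The stacked input $\mathcal U_k(\mathcal I_k)\in\mathbb R^{Nm}$ is a function of $\mathcal I_k$. Predicted trajectory (both protocols): $\widehat{\mathcal X}_k=\Phi X_k+\Gamma\overline\Upsilon\,\mathcal U_k(\mathcal I_k)$. Errors: $\mathbf E_k(\mathcal F_k)=\mathcal X_k-\mathbb E[\mathcal X_k\mid\mathcal F_k,\Upsilon_k]=\Lambda\mathcal W_k$ (TCP-like) and $\mathbf E_k(\mathcal G_k)=\mathcal X_k-\mathbb E[\mathcal X_k\mid\mathcal G_k]=\Gamma(\Upsilon_k-\overline\Upsilon)\mathcal U_k(\mathcal G_k)+\Lambda\mathcal W_k$ (UDP-like). Optimal cost, with $\Omega\in\mathbb R^{Nn\times Nn}$, $\Psi\in\mathbb R^{Nm\times Nm}$, $\mathbf Q\in\mathbb R^{n\times n}$ diagonal positive definite: $$J^*(\mathcal I_k)=\min_{\mathcal U_k(\mathcal I_k)}\mathbb E\big[X_k^{\sf T}\mathbf QX_k+\widehat{\mathcal X}_k^{\sf T}\Omega\widehat{\mathcal X}_k+\mathbf E_k^{\sf T}\Omega\mathbf E_k+\mathcal U_k(\mathcal I_k)^{\sf T}\Upsilon_k^{\sf T}\Psi\Upsilon_k\,\mathcal U_k(\mathcal I_k)\,\big|\,\mathcal I_k\big],$$ where $\mathbf E_k=\mathbf E_k(\mathcal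 I_k)$. Abbreviations: $\Omega_p=\Phi^{\sf T}\Omega\Phi$, $\Omega_g=\Gamma^{\sf T}\Omega\Gamma$, $\Omega_{gp}=\Gamma^{\sf T}\Omega\Phi$, $\Omega_l=\Lambda^{\sf T}\Omega\Lambda$; $\odot$ is the Hadamard (entrywise) product.
   Formalization: The initial state X_0 is assumed jointly independent of all noise vectors and all Bernoulli losses (unstated, but the trace term fails without it); "diagonal positive definite" is read as applying to Ω, Ψ and Q alike. *)

theory Defs
  imports "HOL-Probability.Probability"
begin

section \<open>Matrices\<close>

text \<open>
  On \<^typ>\<open>real^'n^'m\<close> the type-class operations \<open>*\<close>, \<open>1\<close> and \<open>^\<close> are entrywise; the matrix
  product, identity and powers are \<open>**\<close>, \<open>mat 1\<close> and \<open>matpow\<close>.  So \<open>*\<close> is the Hadamard product.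
\<close>

abbreviation hadamard :: "real^'n^'m \<Rightarrow> real^'n^'m \<Rightarrow> real^'n^'m"  (infixl "\<odot>" 70)
  where "A \<odot> B \<equiv> A * B"

definition matpow :: "real^'n^'n \<Rightarrow> nat \<Rightarrow> real^'n^'n"
  where "matpow A r = (((**) A) ^^ r) (mat 1)"

definition diag :: "real^'n \<Rightarrow> real^'n^'n"
  where "diag d = (\<chi> i j. if i = j then d $ i else 0)"

definition is_diagonal :: "real^'n^'n \<Rightarrow> bool"
  where "is_diagonal A \<longleftrightarrow> (\<forall>i j. i \<noteq> j \<longrightarrow> A $ i $ j = 0)"

definition positive_definite :: "real^'n^'n \<Rightarrow> bool"
  where "positive_definite A \<longleftrightarrow> transpose A = A \<and> (\<forall>x. x \<noteq> 0 \<longrightarrow> x \<bullet> (A *v x) > 0)"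

text \<open>
  A horizon of length \<open>N\<close> is a type \<open>'h\<close> of class \<open>{finite, linorder}\<close> with \<open>CARD('h) = N\<close>; such a
  type exists for every \<open>N \<ge> 1\<close> (e.g. the numeral types).  Stacked vectors are indexed by pairs
  (block, component within the block), and \<open>block_no i\<close> is the zero-based number of the block \<open>i\<close>.
\<close>

definition block_no :: "'h::{finite,linorder} \<Rightarrow> nat"
  where "block_no i = card {j. j < i}"

definition block :: "real^('h::finite \<times> 'n) \<Rightarrow> 'h \<Rightarrow> real^'n"
  where "block x h = (\<chi> c. x $ (h, c))"

definition stack :: "('h \<Rightarrow> real^'n) \<Rightarrow> real^('h::finite \<times> 'n)"
  where "stack f = (\<chi> p. f (fst p) $ snd p)"

definition kron :: "real^'h^'h::finite \<Rightarrow> real^'n^'n \<Rightarrow> real^('h \<times> 'n)^('h \<times> 'n)"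
  where "kron A B = (\<chi> p q. A $ fst p $ fst q * B $ snd p $ snd q)"

definition blockdiag :: "('h::finite \<Rightarrow> real^'n^'n) \<Rightarrow> real^('h \<times> 'n)^('h \<times> 'n)"
  where "blockdiag D = (\<chi> p q. if fst p = fst q then D (fst p) $ snd p $ snd q else 0)"

definition Phi_mat :: "real^'n^'n \<Rightarrow> real^'n^('h::{finite,linorder} \<times> 'n)"
  where "Phi_mat A = (\<chi> p b. matpow A (Suc (block_no (fst p))) $ snd p $ b)"

definition Gamma_mat ::
  "real^'n^'n \<Rightarrow> real^'m^'n \<Rightarrow> real^('h \<times> 'm)^('h::{finite,linorder} \<times> 'n)"
  where "Gamma_mat A B =
    (\<chi> p q. if fst q \<le> fst p
            then (matpow A (block_no (fst p) - block_no (fst q)) ** B) $ snd p $ snd q else 0)"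

definition Lambda_mat :: "real^'n^'n \<Rightarrow> real^('h \<times> 'n)^('h::{finite,linorder} \<times> 'n)"
  where "Lambda_mat A =
    (\<chi> p q. if fst q \<le> fst p
            then matpow A (block_no (fst p) - block_no (fst q)) $ snd p $ snd q else 0)"

section \<open>Random vectors\<close>

text \<open>
  \<open>Y\<close> is Gaussian with mean \<open>m\<close> and covariance matrix \<open>S\<close>: every nonzero linear functional of \<open>Y\<close> is
  normally distributed, with the corresponding mean and variance.  To be used with positive definite
  \<open>S\<close>; for singular \<open>S\<close> some functional would be degenerate and have no density.
\<close>

definition gaussian :: "'a measure \<Rightarrow> ('a \<Rightarrow> real^'n) \<Rightarrow> real^'n \<Rightarrow> real^'n^'n \<Rightarrow> bool"
  where "gaussian M Y m S \<longleftrightarrow> Y \<in> borel_measurable M \<and>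
    (\<forall>a. a \<noteq> 0 \<longrightarrow> distributed M lborel (\<lambda>\<omega>. a \<bullet> Y \<omega>)
            (\<lambda>t. ennreal (normal_density (a \<bullet> m) (sqrt (a \<bullet> (S *v a))) t)))"

definition bernoulli :: "'a measure \<Rightarrow> ('a \<Rightarrow> bool) \<Rightarrow> real \<Rightarrow> bool"
  where "bernoulli M b q \<longleftrightarrow> b \<in> measurable M (count_space UNIV) \<and>
    distr M (count_space UNIV) b = measure_pmf (bernoulli_pmf q)"

definition vec_cond_exp :: "'a measure \<Rightarrow> 'a measure \<Rightarrow> ('a \<Rightarrow> real^'n) \<Rightarrow> 'a \<Rightarrow> real^'n"
  where "vec_cond_exp M F Y \<omega> = (\<chi> i. real_cond_exp M F (\<lambda>\<omega>'. Y \<omega>' $ i) \<omega>)"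

text \<open>
  The primitive sources of randomness are the initial state, the noise vectors and the individual
  channel indicators.  They take values in different types, so their joint independence is stated
  with \<^term>\<open>prob_space.indep_sets\<close> for the generated events, which is how
  \<^term>\<open>prob_space.indep_vars\<close> is defined.
\<close>

datatype 'm source = Init | Noise nat | Loss nat 'm

primrec source_events ::
  "'a measure \<Rightarrow> ('a \<Rightarrow> real^'n) \<Rightarrow> (nat \<Rightarrow> 'a \<Rightarrow> real^'n) \<Rightarrow> (nat \<Rightarrow> 'm \<Rightarrow> 'a \<Rightarrow> bool)
    \<Rightarrow> 'm source \<Rightarrow> 'a set set"
  where
    "source_events M X0 W v Init = {X0 -` S \<inter> space M | S. S \<in> sets borel}"
  | "source_events M X0 W v (Noise j) = {W j -` S \<inter> space M | S. S \<in> sets borel}"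
  | "source_events M X0 W v (Loss j i) = {v j i -` S \<inter> space M | S. True}"

section \<open>Plant, information and cost\<close>

definition loss_matrix :: "(nat \<Rightarrow> 'm \<Rightarrow> 'a \<Rightarrow> bool) \<Rightarrow> nat \<Rightarrow> 'a \<Rightarrow> real^'m^'m"
  where "loss_matrix v j \<omega> = diag (\<chi> i. of_bool (v j i \<omega>))"

definition Upsilon ::
  "(nat \<Rightarrow> 'm::finite \<Rightarrow> 'a \<Rightarrow> bool) \<Rightarrow> nat \<Rightarrow> 'a \<Rightarrow> real^('h::{finite,linorder} \<times> 'm)^('h \<times> 'm)"
  where "Upsilon v k \<omega> = blockdiag (\<lambda>h. loss_matrix v (k + block_no h) \<omega>)"

text \<open>The state after a number of steps from \<open>x\<close>, for given loss matrices, inputs and noise.\<close>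

primrec rollout ::
  "real^'n^'n \<Rightarrow> real^'m^'n \<Rightarrow> (nat \<Rightarrow> real^'m^'m) \<Rightarrow> (nat \<Rightarrow> real^'m) \<Rightarrow> (nat \<Rightarrow> real^'n)
    \<Rightarrow> real^'n \<Rightarrow> nat \<Rightarrow> real^'n"
  where
    "rollout A B V u w x 0 = x"
  | "rollout A B V u w x (Suc j) = A *v rollout A B V u w x j + B *v (V j *v u j) + w j"

text \<open>
  The stacked future states \<open>X\<^bsub>k+1\<^esub>, \<dots>, X\<^bsub>k+N\<^esub>\<close> when the plant is driven from \<open>X\<^bsub>k\<^esub>\<close> by the blocks of the
  stacked input \<open>u\<close>.
\<close>

definition stacked_state ::
  "real^'n^'n \<Rightarrow> real^'m^'n \<Rightarrow> (nat \<Rightarrow> 'a \<Rightarrow> real^'n) \<Rightarrow> (nat \<Rightarrow> 'a \<Rightarrow> real^'n)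
    \<Rightarrow> (nat \<Rightarrow> 'm \<Rightarrow> 'a \<Rightarrow> bool) \<Rightarrow> nat \<Rightarrow> ('a \<Rightarrow> real^('h::{finite,linorder} \<times> 'm))
    \<Rightarrow> 'a \<Rightarrow> real^('h \<times> 'n)"
  where "stacked_state A B X W v k u \<omega> =
    stack (\<lambda>h. rollout A B (\<lambda>j. loss_matrix v (k + j) \<omega>) (\<lambda>j. block (u \<omega>) (inv block_no j))
                 (\<lambda>j. W (k + j) \<omega>) (X k \<omega>) (Suc (block_no h)))"

datatype protocol = TCP | UDP

definition state_events :: "'a measure \<Rightarrow> (nat \<Rightarrow> 'a \<Rightarrow> real^'n) \<Rightarrow> nat \<Rightarrow> 'a set set"
  where "state_events M X k = {X j -` S \<inter> space M | j S. j \<le> k \<and> S \<in> sets borel}"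

definition loss_events :: "'a measure \<Rightarrow> (nat \<Rightarrow> 'm \<Rightarrow> 'a \<Rightarrow> bool) \<Rightarrow> nat \<Rightarrow> 'a set set"
  where "loss_events M v k = {v j i -` S \<inter> space M | j i S. j < k}"

text \<open>
  The information sets are represented by the sigma-algebras they generate; an input is a function
  of the information iff it is measurable with respect to that sigma-algebra.
\<close>

primrec info ::
  "protocol \<Rightarrow> 'a measure \<Rightarrow> (nat \<Rightarrow> 'a \<Rightarrow> real^'n) \<Rightarrow> (nat \<Rightarrow> 'm \<Rightarrow> 'a \<Rightarrow> bool) \<Rightarrow> nat \<Rightarrow> 'a measure"
  where
    "info TCP M X v k = sigma (space M) (state_events M X k \<union> loss_events M v k)"
  | "info UDP M X v k = sigma (space M) (state_events M X k)"

text \<open>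
  The sigma-algebra on which the true trajectory is conditioned in the error term.  For TCP it is
  generated by the information at time \<open>k\<close> together with the loss matrices at times
  \<open>k, \<dots>, k + N - 1\<close>, hence by the states up to \<open>k\<close> and all losses before \<open>k + N\<close>.
\<close>

primrec err_info ::
  "protocol \<Rightarrow> 'a measure \<Rightarrow> (nat \<Rightarrow> 'a \<Rightarrow> real^'n) \<Rightarrow> (nat \<Rightarrow> 'm \<Rightarrow> 'a \<Rightarrow> bool) \<Rightarrow> nat \<Rightarrow> nat
    \<Rightarrow> 'a measure"
  where
    "err_info TCP M X v k N = sigma (space M) (state_events M X k \<union> loss_events M v (k + N))"
  | "err_info UDP M X v k N = info UDP M X v k"

definition err ::
  "protocol \<Rightarrow> 'a measure \<Rightarrow> real^'n^'n \<Rightarrow> real^'m^'n \<Rightarrow> (nat \<Rightarrow> 'a \<Rightarrow> real^'n)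
    \<Rightarrow> (nat \<Rightarrow> 'a \<Rightarrow> real^'n) \<Rightarrow> (nat \<Rightarrow> 'm \<Rightarrow> 'a \<Rightarrow> bool) \<Rightarrow> nat
    \<Rightarrow> ('a \<Rightarrow> real^('h::{finite,linorder} \<times> 'm)) \<Rightarrow> 'a \<Rightarrow> real^('h \<times> 'n)"
  where "err p M A B X W v k u \<omega> =
    stacked_state A B X W v k u \<omega>
    - vec_cond_exp M (err_info p M X v k CARD('h)) (stacked_state A B X W v k u) \<omega>"

definition predicted ::
  "real^'n^'n \<Rightarrow> real^'m^'n \<Rightarrow> real^'m \<Rightarrow> real^'n \<Rightarrow> real^('h::{finite,linorder} \<times> 'm)
    \<Rightarrow> real^('h \<times> 'n)"
  where "predicted A B \<mu> x u = Phi_mat A *v x + Gamma_mat A B *v (kron (mat 1) (diag \<mu>) *v u)"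

text \<open>
  The conditional expected cost of the stacked input \<open>u\<close>.  For the weights considered here the random
  cost is nonnegative, so if its conditional expectation were infinite on a set of positive measure,
  \<^term>\<open>real_cond_exp\<close> would wrongly return 0 there.  That does not occur: an input measurable
  with respect to the information is finite and acts as a constant under the conditioning, and
  the noise has second moments.  No integrability of \<open>u\<close> is therefore required.
\<close>

definition cond_cost ::
  "protocol \<Rightarrow> 'a measure \<Rightarrow> real^'n^'n \<Rightarrow> real^'m^'n \<Rightarrow> real^'m \<Rightarrow> real^'n^'n
    \<Rightarrow> real^('h \<times> 'n)^('h \<times> 'n) \<Rightarrow> real^('h \<times> 'm)^('h \<times> 'm)
    \<Rightarrow> (nat \<Rightarrow> 'a \<Rightarrow> real^'n) \<Rightarrow> (nat \<Rightarrow> 'a \<Rightarrow> real^'n) \<Rightarrow> (nat \<Rightarrow> 'm \<Rightarrow> 'a \<Rightarrow> bool) \<Rightarrow> nat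
    \<Rightarrow> ('a \<Rightarrow> real^('h::{finite,linorder} \<times> 'm)) \<Rightarrow> 'a \<Rightarrow> real"
  where "cond_cost p M A B \<mu> Q \<Omega> \<Psi> X W v k u =
    real_cond_exp M (info p M X v k) (\<lambda>\<omega>.
      X k \<omega> \<bullet> (Q *v X k \<omega>)
      + predicted A B \<mu> (X k \<omega>) (u \<omega>) \<bullet> (\<Omega> *v predicted A B \<mu> (X k \<omega>) (u \<omega>))
      + err p M A B X W v k u \<omega> \<bullet> (\<Omega> *v err p M A B X W v k u \<omega>)
      + u \<omega> \<bullet> ((transpose (Upsilon v k \<omega>) ** \<Psi> ** Upsilon v k \<omega>) *v u \<omega>))"

text \<open>
  Minimisation of a conditional cost \<open>J\<close> over all \<open>F\<close>-measurable inputs.  Conditional expectations are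
  determined only almost everywhere, so costs are compared almost everywhere.
\<close>

definition is_optimal_input ::
  "'a measure \<Rightarrow> 'a measure \<Rightarrow> (('a \<Rightarrow> real^'d) \<Rightarrow> 'a \<Rightarrow> real) \<Rightarrow> ('a \<Rightarrow> real^'d) \<Rightarrow> bool"
  where "is_optimal_input M F J u \<longleftrightarrow> u \<in> borel_measurable F \<and>
    (\<forall>u' \<in> borel_measurable F. AE \<omega> in M. J u \<omega> \<le> J u' \<omega>)"

definition is_optimal_cost ::
  "'a measure \<Rightarrow> 'a measure \<Rightarrow> (('a \<Rightarrow> real^'d) \<Rightarrow> 'a \<Rightarrow> real) \<Rightarrow> ('a \<Rightarrow> real) \<Rightarrow> bool"
  where "is_optimal_cost M F J c \<longleftrightarrow>
    (\<exists>u. is_optimal_input M F J u \<and> (AE \<omega> in M. c \<omega> = J u \<omega>))"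

section \<open>The stacked form of the dynamics\<close>

lemma block_no_less: "i < j \<Longrightarrow> block_no i < block_no j"
  unfolding block_no_def by (intro psubset_card_mono) auto

lemma block_no_le_iff: "block_no i \<le> block_no j \<longleftrightarrow> i \<le> j"
  using block_no_less[of i j] block_no_less[of j i] by (cases i j rule: linorder_cases) auto

lemma inj_block_no: "inj block_no"
  by (metis block_no_less injI less_irrefl linorder_neq_iff)

lemma bij_block_no: "bij_betw block_no (UNIV :: 'h::{finite,linorder} set) {..<CARD('h)}"
proof -
  have "block_no ` (UNIV :: 'h set) \<subseteq> {..<CARD('h)}"
    unfolding block_no_def by (auto intro!: psubset_card_mono)
  moreover have "card (block_no ` (UNIV :: 'h set)) = CARD('h)"
    by (intro card_image inj_block_no)
  ultimately have "block_no ` (UNIV :: 'h set) = {..<CARD('h)}"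
    by (metis card_lessThan card_subset_eq finite_lessThan)
  then show ?thesis using inj_block_no by (simp add: bij_betw_def)
qed

lemma matpow_simps: "matpow A 0 = mat 1" "matpow A (Suc r) = A ** matpow A r"
  by (simp_all add: matpow_def)

lemma rollout_closed:
  "rollout A B V u w x n = matpow A n *v x
     + (\<Sum>j<n. matpow A (n - Suc j) *v (B *v (V j *v u j) + w j))"
proof (induction n)
  case (Suc n)
  have "(\<Sum>j<n. matpow A (n - j) *v z j) = A *v (\<Sum>j<n. matpow A (n - Suc j) *v z j)" for z
    unfolding vec.sum matrix_vector_mul_assoc
    by (rule sum.cong) (auto simp: matpow_simps(2)[symmetric] Suc_diff_Suc)
  with Suc show ?case
    by (simp add: matpow_simps matrix_vector_mul_assoc[of A "matpow A n", symmetric] matrix_vector_right_distrib[of A] add_ac)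
qed (simp add: matpow_simps)

lemma block_lower_triangular_mult:
  fixes F :: "nat \<Rightarrow> real^'b^'n" and y :: "real^('h::{finite,linorder} \<times> 'b)"
  shows "((\<chi> p q. if fst q \<le> fst p then F (block_no (fst p) - block_no (fst q)) $ snd p $ snd q else 0) *v y) $ (h, c)
    = (\<Sum>j<Suc (block_no h). F (block_no h - j) *v block y (inv block_no j)) $ c"
proof -
  have "(\<Sum>j<Suc (block_no h). F (block_no h - j) *v block y (inv block_no j))
      = (\<Sum>h'\<in>{..h}. F (block_no h - block_no h') *v block y h')"
  proof -
    have "block_no ` {..h} = {..<Suc (block_no h)}"
    proof (intro set_eqI iffI)
      fix x assume x: "x \<in> {..<Suc (block_no h)}"
      have "block_no h < CARD('h)" using bij_betwE[OF bij_block_no] by auto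
      then obtain h' :: 'h where "x = block_no h'" using x bij_block_no
        by (metis bij_betw_iff_bijections less_Suc_eq_le lessThan_iff order_le_less_trans)
      then show "x \<in> block_no ` {..h}" using x using block_no_le_iff[of h' h] by (auto simp: less_Suc_eq_le)
    qed (auto simp: block_no_le_iff less_Suc_eq_le)
    then have "bij_betw block_no {..h} {..<Suc (block_no h)}"
      using inj_block_no by (auto simp: bij_betw_def intro: inj_on_subset)
    from sum.reindex_bij_betw[OF this, symmetric, of "\<lambda>j. F (block_no h - j) *v block y (inv block_no j)"] show ?thesis by (simp add: inj_block_no del: sum.lessThan_Suc)
  qed
  also have "\<dots> $ c = (\<Sum>h'\<in>UNIV. if h' \<le> h then (F (block_no h - block_no h') *v block y h') $ c else 0)"
    by (simp add: sum.If_cases atMost_def)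
  also have "\<dots> = (\<Sum>h'\<in>UNIV. \<Sum>b\<in>UNIV. (if h' \<le> h then F (block_no h - block_no h') $ c $ b else 0) * y $ (h', b))"
    by (intro sum.cong) (auto simp: matrix_vector_mult_def block_def)
  also have "\<dots> = (\<Sum>q\<in>UNIV. (if fst q \<le> h then F (block_no h - block_no (fst q)) $ c $ snd q else 0) * y $ q)"
    by (simp add: sum.cartesian_product UNIV_Times_UNIV[symmetric] case_prod_beta del: UNIV_Times_UNIV)
  finally show ?thesis by (simp add: matrix_vector_mult_def cong: if_cong)
qed

lemma stacked_state_eq:
  fixes u :: "'a \<Rightarrow> real^('d::{finite,linorder} \<times> 'm::finite)" and A :: "real^'n^'n"
  shows "stacked_state A B X W v k u \<omega> =
    Phi_mat A *v X k \<omega> + Gamma_mat A B *v (Upsilon v k \<omega> *v u \<omega>)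
    + Lambda_mat A *v stack (\<lambda>h. W (k + block_no h) \<omega>)"
  (is "?L = ?R")
proof -
  have Phi: "(Phi_mat A *v x) $ (h::'d, c) = (matpow A (Suc (block_no h)) *v x) $ c" for x h c
    by (simp add: Phi_mat_def matrix_vector_mult_def)
  have U: "block (Upsilon v k \<omega> *v y) h = loss_matrix v (k + block_no h) \<omega> *v block y h"
    for h :: 'd and y
  proof -
    have "(\<Sum>q\<in>UNIV. (if h = fst q then loss_matrix v (k + block_no h) \<omega> $ c $ snd q else 0) * y $ q)
      = (\<Sum>h'\<in>UNIV. \<Sum>b\<in>UNIV. (if h = h' then loss_matrix v (k + block_no h) \<omega> $ c $ b else 0) * y $ (h', b))" for c
      by (simp add: sum.cartesian_product UNIV_Times_UNIV[symmetric] case_prod_beta del: UNIV_Times_UNIV)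
    also have "\<dots> c = (\<Sum>h'\<in>UNIV. if h = h' then (\<Sum>b\<in>UNIV. loss_matrix v (k + block_no h) \<omega> $ c $ b * y $ (h', b)) else 0)" for c
      by (intro sum.cong) auto
    finally show ?thesis
      by (simp add: vec_eq_iff block_def Upsilon_def blockdiag_def matrix_vector_mult_def cong: if_cong)
  qed
  have inv: "block_no (inv block_no j :: 'd) = j" if "j < Suc (block_no (h::'d))" for j h
  proof -
    have "block_no h < CARD('d)" using bij_betwE[OF bij_block_no] by auto
    with that have "j \<in> range (block_no :: 'd \<Rightarrow> nat)" using bij_block_no[where 'h='d] by (auto simp: bij_betw_def)
    then show ?thesis by (simp add: f_inv_into_f)
  qed
  have S: "block (stack f) h = f h" for f :: "'d \<Rightarrow> real^'b" and h by (simp add: block_def stack_def)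
  have "?L $ (h, c) = ?R $ (h, c)" for h c
    unfolding Gamma_mat_def Lambda_mat_def vector_add_component Phi
      block_lower_triangular_mult[where F="matpow A"] block_lower_triangular_mult[where F="\<lambda>r. matpow A r ** B"] U S
    by (simp add: stacked_state_def stack_def rollout_closed inv matrix_vector_right_distrib
        matrix_vector_mul_assoc matrix_mul_assoc sum.distrib del: sum.lessThan_Suc rollout.simps cong: sum.cong_simp)
  then show ?thesis by (simp add: vec_eq_iff)
qed

end

theory Submission
  imports Defs
begin

text \<open>
  Given the information at time \<open>k\<close>, the state and the input are constants, while the losses and the noise
  from time \<open>k\<close> on are independent of it.  Taking conditional expectations turns the cost into a
  quadratic form in the input: the noise contributes the trace term, cross terms vanish, and distinct
  losses are uncorrelated, so that the losses only contribute diagonal terms.  With \<open>Ub\<close> the matrix of loss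
  rates, the quadratic part is given by the symmetric positive definite matrix \<open>Ub ** G\<close>, and the linear part by
  \<open>Ub ** \<Omega>gp\<close>.  Completing the square gives the unique minimiser, in which \<open>Ub\<close> cancels.
\<close>

section \<open>Conditional expectations of locally integrable functions\<close>

text \<open>\<open>G\<close> is in general not symmetric, so convexity cannot be argued on it
  directly. Multiplied on the left by the loss rates it becomes \<open>Ub ** \<Omega>g ** Ub\<close>
  plus a positive diagonal matrix; the latter alone is definite, so \<Gamma> may have a kernel. The
  two protocols differ only in this diagonal, and one quadratic problem serves both. For diagonal
  \<Psi> no product of distinct losses occurs in the input cost, and a 0/1 variable equals its
  square, so \<Psi> is weighted by \<mu>. Under UDP the loss variance \<mu> (1 - \<mu>), weighted by
  the diagonal of \<open>\<Omega>g\<close>, adds the Hadamard term, one factor \<mu> being absorbed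
  by \<open>Ub\<close>. The probabilistic obstacle is the feedback: states and inputs up to time k
  depend on each other, and the information is generated by states rather than by the primitive
  sources. An induction over time places it in the sigma-algebra of the sources before k;
  independence then becomes a comparison of index sets.\<close>

text \<open>
  An admissible input is only required to be measurable, so its cost need not be integrable.  Multiplying
  by \<open>w\<close> makes it so, and \<open>w\<close> can afterwards be pulled out of the conditional expectation and cancelled.
\<close>

definition has_cond_exp :: "'a measure \<Rightarrow> 'a measure \<Rightarrow> ('a \<Rightarrow> real) \<Rightarrow> ('a \<Rightarrow> real) \<Rightarrow> bool"
  where "has_cond_exp M F f g \<longleftrightarrow> f \<in> borel_measurable M \<and> g \<in> borel_measurable F \<and>
    (\<exists>w \<in> borel_measurable F. (\<forall>x. 0 < w x) \<and> integrable M (\<lambda>x. w x * f x) \<and>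
      (AE x in M. real_cond_exp M F (\<lambda>x. w x * f x) x = w x * g x))"

lemma has_cond_expI:
  assumes "f \<in> borel_measurable M" "g \<in> borel_measurable F" "w \<in> borel_measurable F" "\<And>x. 0 < w x"
    "integrable M (\<lambda>x. w x * f x)" "AE x in M. real_cond_exp M F (\<lambda>x. w x * f x) x = w x * g x"
  shows "has_cond_exp M F f g"
  using assms unfolding has_cond_exp_def by blast

lemma has_cond_exp_measurable:
  assumes "has_cond_exp M F f g"
  shows "f \<in> borel_measurable M"
  using assms unfolding has_cond_exp_def by blast

text \<open>\<open>real_cond_exp_mult\<close> would demand integrability of the product. For
  positive \<open>w\<close> the positive and negative parts of \<open>f\<close> scale separately,
  and a nonnegative conditional expectation releases \<open>w\<close> without any
  integrability.\<close>

lemma (in finite_measure_subalgebra) real_cond_exp_mult_pos: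
  assumes [measurable]: "w \<in> borel_measurable F" "f \<in> borel_measurable M" and w: "\<And>x. 0 < w x"
  shows "AE x in M. real_cond_exp M F (\<lambda>x. w x * f x) x = w x * real_cond_exp M F f x"
proof -
  have eq: "ennreal (w x * y) = ennreal (w x) * ennreal y"
    "ennreal (- (w x * y)) = ennreal (w x) * ennreal (- y)" for x y
    using w[of x] ennreal_mult'[of "w x" y] ennreal_mult'[of "w x" "- y"] by (simp_all add: less_imp_le)
  have "AE x in M. ennreal (w x) * nn_cond_exp M F (\<lambda>x. ennreal (f x)) x = nn_cond_exp M F (\<lambda>x. ennreal (w x) * ennreal (f x)) x"
    by (intro nn_cond_exp_prod) auto
  moreover have "AE x in M. ennreal (w x) * nn_cond_exp M F (\<lambda>x. ennreal (- f x)) x = nn_cond_exp M F (\<lambda>x. ennreal (w x) * ennreal (- f x)) x"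
    by (intro nn_cond_exp_prod) auto
  ultimately show ?thesis
  proof eventually_elim
    case (elim x)
    then show ?case
      \<comment> \<open>Multiplicativity of \<open>enn2real\<close> needs no finiteness: an infinite
        conditional expectation is sent to 0 on both sides.\<close>
      using w[of x] unfolding real_cond_exp_def eq
      by (metis enn2real_ennreal enn2real_mult less_imp_le right_diff_distrib)
  qed
qed

lemma (in finite_measure_subalgebra) has_cond_exp_imp_eq:
  assumes "has_cond_exp M F f g"
  shows "AE x in M. real_cond_exp M F f x = g x"
proof -
  from assms obtain w where w: "w \<in> borel_measurable F" "\<And>x. 0 < w x"
    and ae: "AE x in M. real_cond_exp M F (\<lambda>x. w x * f x) x = w x * g x"
    and f: "f \<in> borel_measurable M"
    unfolding has_cond_exp_def by blast
  from ae real_cond_exp_mult_pos[OF w(1) f w(2)] show ?thesis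
    by eventually_elim (use w(2) in \<open>metis mult_cancel_left less_irrefl\<close>)
qed

text \<open>The quotient \<open>w' / w\<close> is measurable for \<open>F\<close> and lies between 0
  and 1, so it can be pulled out of an integrable function. Two functions with different weights can
  thus be given a common one, the minimum.\<close>

lemma (in finite_measure_subalgebra) weight_mono:
  assumes [measurable]: "w \<in> borel_measurable F" "w' \<in> borel_measurable F" "f \<in> borel_measurable M"
    and w: "\<And>x. 0 < w' x" "\<And>x. w' x \<le> w x"
    and int: "integrable M (\<lambda>x. w x * f x)"
    and ae: "AE x in M. real_cond_exp M F (\<lambda>x. w x * f x) x = w x * g x"
  shows "integrable M (\<lambda>x. w' x * f x)"
    and "AE x in M. real_cond_exp M F (\<lambda>x. w' x * f x) x = w' x * g x"
proof -
  have [measurable]: "w' \<in> borel_measurable M" by (rule measurable_from_subalg[OF subalg]) fact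
  have pos: "0 < w x" for x using w(1)[of x] w(2)[of x] by linarith
  have eq: "w' x * y = w' x / w x * (w x * y)" for x y
    using pos[of x] by simp
  show int': "integrable M (\<lambda>x. w' x * f x)"
  proof (rule Bochner_Integration.integrable_bound[OF int])
    show "(\<lambda>x. w' x * f x) \<in> borel_measurable M" by measurable
    have "\<bar>w' x\<bar> * \<bar>f x\<bar> \<le> \<bar>w x\<bar> * \<bar>f x\<bar>" for x
      using w(1)[of x] w(2)[of x] by (intro mult_right_mono) auto
    then show "AE x in M. norm (w' x * f x) \<le> norm (w x * f x)" by (simp add: abs_mult)
  qed
  have "AE x in M. real_cond_exp M F (\<lambda>x. w' x / w x * (w x * f x)) x
      = w' x / w x * real_cond_exp M F (\<lambda>x. w x * f x) x"
  proof (rule real_cond_exp_mult)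
    show "(\<lambda>x. w' x / w x) \<in> borel_measurable F" by measurable
    show "(\<lambda>x. w x * f x) \<in> borel_measurable M" by (rule borel_measurable_integrable[OF int])
    show "integrable M (\<lambda>x. w' x / w x * (w x * f x))" using int' by (simp only: eq[symmetric])
  qed
  with ae show "AE x in M. real_cond_exp M F (\<lambda>x. w' x * f x) x = w' x * g x"
  proof eventually_elim
    case (elim x)
    then show ?case by (simp only: eq[symmetric])
  qed
qed

lemma (in finite_measure_subalgebra) has_cond_exp_add:
  assumes "has_cond_exp M F f g" "has_cond_exp M F f' g'"
  shows "has_cond_exp M F (\<lambda>x. f x + f' x) (\<lambda>x. g x + g' x)"
proof -
  from assms(1) obtain w where w: "w \<in> borel_measurable F" "\<And>x. 0 < w x"
    and int: "integrable M (\<lambda>x. w x * f x)"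
    and ae: "AE x in M. real_cond_exp M F (\<lambda>x. w x * f x) x = w x * g x"
    and f: "f \<in> borel_measurable M" "g \<in> borel_measurable F"
    unfolding has_cond_exp_def by blast
  from assms(2) obtain w' where w': "w' \<in> borel_measurable F" "\<And>x. 0 < w' x"
    and int': "integrable M (\<lambda>x. w' x * f' x)"
    and ae': "AE x in M. real_cond_exp M F (\<lambda>x. w' x * f' x) x = w' x * g' x"
    and f': "f' \<in> borel_measurable M" "g' \<in> borel_measurable F"
    unfolding has_cond_exp_def by blast
  define m where "m x = min (w x) (w' x)" for x
  have m: "m \<in> borel_measurable F" "\<And>x. 0 < m x" "\<And>x. m x \<le> w x" "\<And>x. m x \<le> w' x"
    using w w' by (auto simp: m_def[abs_def])
  note W = weight_mono[OF w(1) m(1) f(1) m(2,3) int ae]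
  note W' = weight_mono[OF w'(1) m(1) f'(1) m(2,4) int' ae']
  show ?thesis
  proof (rule has_cond_expI[OF _ _ m(1,2)])
    show "integrable M (\<lambda>x. m x * (f x + f' x))"
      using W(1) W'(1) by (simp add: distrib_left)
    from real_cond_exp_add[OF W(1) W'(1)] W(2) W'(2)
    show "AE x in M. real_cond_exp M F (\<lambda>x. m x * (f x + f' x)) x = m x * (g x + g' x)"
      by eventually_elim (simp add: distrib_left)
  qed (use f f' in auto)
qed

lemma (in finite_measure_subalgebra) has_cond_exp_mult:
  assumes c: "c \<in> borel_measurable F" and f: "has_cond_exp M F f g"
  shows "has_cond_exp M F (\<lambda>x. c x * f x) (\<lambda>x. c x * g x)"
proof -
  from f obtain w where w: "w \<in> borel_measurable F" "\<And>x. 0 < w x"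
    and int: "integrable M (\<lambda>x. w x * f x)"
    and ae: "AE x in M. real_cond_exp M F (\<lambda>x. w x * f x) x = w x * g x"
    and f: "f \<in> borel_measurable M" "g \<in> borel_measurable F"
    unfolding has_cond_exp_def by blast
  have cM: "c \<in> borel_measurable M" using c by (rule measurable_from_subalg[OF subalg])
  have wM: "w \<in> borel_measurable M" using w(1) by (rule measurable_from_subalg[OF subalg])
  \<comment> \<open>The multiplier \<open>c\<close> may be unbounded. Dividing the weight by
    \<open>1 + |c|\<close> replaces it by a factor of absolute value at most 1, which preserves
    integrability.\<close>
  define m where "m x = w x / (1 + \<bar>c x\<bar>)" for x
  have m: "m \<in> borel_measurable F" "0 < m x" for x
    using w c by (auto simp: m_def[abs_def] intro: divide_pos_pos add_pos_nonneg)
  have eq: "m x * (c x * y) = c x / (1 + \<bar>c x\<bar>) * (w x * y)" for x y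
    by (simp add: m_def)
  have "\<bar>c x / (1 + \<bar>c x\<bar>)\<bar> \<le> 1" for x by (simp add: divide_le_eq)
  then have le: "\<bar>c x / (1 + \<bar>c x\<bar>) * (w x * f x)\<bar> \<le> \<bar>w x * f x\<bar>" for x
    unfolding abs_mult[of "c x / (1 + \<bar>c x\<bar>)"] by (intro mult_left_le_one_le) auto
  have int': "integrable M (\<lambda>x. c x / (1 + \<bar>c x\<bar>) * (w x * f x))"
    by (rule Bochner_Integration.integrable_bound[OF int]) (use le cM wM f in auto)
  have "AE x in M. real_cond_exp M F (\<lambda>x. c x / (1 + \<bar>c x\<bar>) * (w x * f x)) x
      = c x / (1 + \<bar>c x\<bar>) * real_cond_exp M F (\<lambda>x. w x * f x) x"
    by (rule real_cond_exp_mult[OF _ _ int']) (use c wM f in auto)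
  with ae have "AE x in M. real_cond_exp M F (\<lambda>x. m x * (c x * f x)) x = m x * (c x * g x)"
    by eventually_elim (simp add: eq)
  then show ?thesis
    by (intro has_cond_expI[OF _ _ m]) (use int' f c cM in \<open>auto simp: eq\<close>)
qed

lemma (in finite_measure_subalgebra) has_cond_exp_F_meas:
  assumes c: "c \<in> borel_measurable F"
  shows "has_cond_exp M F c c"
proof -
  have "has_cond_exp M F (\<lambda>_. 1) (\<lambda>_. 1)"
    by (rule has_cond_expI[where w="\<lambda>_. 1"])
       auto
  from has_cond_exp_mult[OF c this] show ?thesis by simp
qed

lemma (in finite_measure_subalgebra) has_cond_exp_sum:
  assumes "\<And>i. i \<in> I \<Longrightarrow> has_cond_exp M F (f i) (g i)"
  shows "has_cond_exp M F (\<lambda>x. \<Sum>i\<in>I. f i x) (\<lambda>x. \<Sum>i\<in>I. g i x)"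
proof (cases "finite I")
  case True
  then show ?thesis using assms
    by induction (auto intro: has_cond_exp_add has_cond_exp_F_meas)
qed (auto intro: has_cond_exp_F_meas)

text \<open>For an event \<open>A\<close> of \<open>F\<close>, independence splits the integral of
  \<open>Z\<close> over \<open>A\<close> into the probability of \<open>A\<close> times the mean of
  \<open>Z\<close>, which is the averaging property of a conditional expectation. As
  \<open>Z\<close> is integrable, the weight 1 suffices.\<close>

lemma (in prob_space) has_cond_exp_indep:
  assumes sub: "subalgebra M F" and int: "integrable M Z"
    and ind: "\<And>A. A \<in> sets F \<Longrightarrow> indep_var borel (indicator A) borel Z"
  shows "has_cond_exp M F Z (\<lambda>_. expectation Z)"
proof -
  interpret finite_measure_subalgebra M F by unfold_locales (rule sub)
  have "AE x in M. real_cond_exp M F Z x = expectation Z"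
  proof (rule real_cond_exp_charact)
    fix A assume A: "A \<in> sets F"
    then have AM: "A \<in> events" using sub by (auto simp: subalgebra_def)
    have "(\<integral>x\<in>A. Z x \<partial>M) = expectation (\<lambda>x. indicator A x * Z x)"
      by (simp add: set_lebesgue_integral_def)
    also have "\<dots> = expectation (indicator A) * expectation Z"
      using AM int by (intro indep_var_lebesgue_integral ind[OF A]) (auto simp: emeasure_eq_measure)
    finally show "(\<integral>x\<in>A. Z x \<partial>M) = (\<integral>x\<in>A. expectation Z \<partial>M)"
      using AM by (simp add: set_lebesgue_integral_def)
  qed (use int in auto)
  then show ?thesis
    by (intro has_cond_expI[where w="\<lambda>_. 1"]) (use int in auto)
qed

section \<open>Moments and independence of the sources\<close>

text \<open>Positive definiteness makes the standard deviation of \<open>a \<bullet> Y\<close>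
  positive for nonzero \<open>a\<close>, so the facts on normal densities apply. The case
  \<open>a = 0\<close>, on which \<open>gaussian\<close> is silent, is trivial.\<close>

lemma (in prob_space) gaussian_second_moment:
  assumes S: "positive_definite S" and Y: "gaussian M Y m S"
  shows "integrable M (\<lambda>\<omega>. a \<bullet> Y \<omega>)" "expectation (\<lambda>\<omega>. a \<bullet> Y \<omega>) = a \<bullet> m"
    "integrable M (\<lambda>\<omega>. (a \<bullet> Y \<omega> - a \<bullet> m)\<^sup>2)"
    "expectation (\<lambda>\<omega>. (a \<bullet> Y \<omega> - a \<bullet> m)\<^sup>2) = a \<bullet> (S *v a)"
proof -
  have "integrable M (\<lambda>\<omega>. a \<bullet> Y \<omega>) \<and> expectation (\<lambda>\<omega>. a \<bullet> Y \<omega>) = a \<bullet> m \<and>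
    integrable M (\<lambda>\<omega>. (a \<bullet> Y \<omega> - a \<bullet> m)\<^sup>2) \<and>
    expectation (\<lambda>\<omega>. (a \<bullet> Y \<omega> - a \<bullet> m)\<^sup>2) = a \<bullet> (S *v a)"
  proof (cases "a = 0")
    case False
    define \<sigma> where "\<sigma> = sqrt (a \<bullet> (S *v a))"
    have pos: "0 < \<sigma>" using S False by (simp add: \<sigma>_def positive_definite_def)
    have D: "distributed M lborel (\<lambda>\<omega>. a \<bullet> Y \<omega>) (normal_density (a \<bullet> m) \<sigma>)"
      using Y False by (simp add: gaussian_def \<sigma>_def)
    have e: "expectation (\<lambda>\<omega>. a \<bullet> Y \<omega>) = a \<bullet> m"
      by (rule normal_distributed_expectation[OF pos D])
    have "integrable M (\<lambda>\<omega>. a \<bullet> Y \<omega>)"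
      using distributed_integrable[OF D, of "\<lambda>x. x"] integrable_normal_moment_nz_1[OF pos, of "a \<bullet> m"] by simp
    moreover have "integrable M (\<lambda>\<omega>. (a \<bullet> Y \<omega> - a \<bullet> m)\<^sup>2)"
      using distributed_integrable[OF D, of "\<lambda>x. (x - a \<bullet> m)\<^sup>2"] integrable_normal_moment[OF pos, of "a \<bullet> m" 2] by simp
    moreover have "expectation (\<lambda>\<omega>. (a \<bullet> Y \<omega> - a \<bullet> m)\<^sup>2) = a \<bullet> (S *v a)"
      using normal_distributed_variance[OF pos D] pos by (simp add: e \<sigma>_def)
    ultimately show ?thesis using e by simp
  qed simp
  then show "integrable M (\<lambda>\<omega>. a \<bullet> Y \<omega>)" "expectation (\<lambda>\<omega>. a \<bullet> Y \<omega>) = a \<bullet> m"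
    "integrable M (\<lambda>\<omega>. (a \<bullet> Y \<omega> - a \<bullet> m)\<^sup>2)"
    "expectation (\<lambda>\<omega>. (a \<bullet> Y \<omega> - a \<bullet> m)\<^sup>2) = a \<bullet> (S *v a)" by auto
qed

text \<open>\<open>gaussian\<close> speaks only of single linear functionals, so mixed moments come
  from polarisation. This yields the average of \<open>S $ c $ d\<close> and
  \<open>S $ d $ c\<close>, which coincide by symmetry.\<close>

lemma (in prob_space) centered_gaussian_covariance:
  assumes S: "positive_definite S" and Y: "gaussian M Y 0 S"
  shows "integrable M (\<lambda>\<omega>. Y \<omega> $ c * Y \<omega> $ d)" "expectation (\<lambda>\<omega>. Y \<omega> $ c * Y \<omega> $ d) = S $ c $ d"
proof -
  note sq = gaussian_second_moment(3,4)[OF S Y, simplified]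
  let ?c = "axis c 1 :: real^'b" and ?d = "axis d 1 :: real^'b"
  have polar: "Y \<omega> $ c * Y \<omega> $ d = (((?c + ?d) \<bullet> Y \<omega>)\<^sup>2 - (?c \<bullet> Y \<omega>)\<^sup>2 - (?d \<bullet> Y \<omega>)\<^sup>2) / 2" for \<omega>
    by (simp add: inner_add_left inner_axis' power2_eq_square algebra_simps)
  show "integrable M (\<lambda>\<omega>. Y \<omega> $ c * Y \<omega> $ d)"
    unfolding polar by (intro integrable_divide Bochner_Integration.integrable_diff sq)
  have entry: "axis i 1 \<bullet> (S *v axis j 1) = S $ i $ j" for i j
    by (simp add: inner_axis' matrix_vector_mul_component inner_axis)
  have "S $ d $ c = S $ c $ d"
    using S unfolding positive_definite_def by (metis transpose_def vec_lambda_beta)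
  moreover have "expectation (\<lambda>\<omega>. Y \<omega> $ c * Y \<omega> $ d)
      = ((?c + ?d) \<bullet> (S *v (?c + ?d)) - ?c \<bullet> (S *v ?c) - ?d \<bullet> (S *v ?d)) / 2"
    unfolding polar by (simp add: sq)
  ultimately show "expectation (\<lambda>\<omega>. Y \<omega> $ c * Y \<omega> $ d) = S $ c $ d"
    by (simp add: matrix_vector_right_distrib inner_add_left inner_add_right entry)
qed

lemma (in prob_space) bernoulli_moment:
  assumes b: "bernoulli M b q" and q: "0 \<le> q" "q \<le> 1"
  shows "integrable M (\<lambda>\<omega>. of_bool (b \<omega>) :: real)" "expectation (\<lambda>\<omega>. of_bool (b \<omega>)) = q"
proof -
  have [measurable]: "b \<in> measurable M (count_space UNIV)"
    and D: "distr M (count_space UNIV) b = measure_pmf (bernoulli_pmf q)"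
    using b by (auto simp: bernoulli_def)
  show "integrable M (\<lambda>\<omega>. of_bool (b \<omega>) :: real)"
    by (intro integrable_const_bound[where B=1]) auto
  have "expectation (\<lambda>\<omega>. of_bool (b \<omega>) :: real) = (\<integral>x. of_bool x \<partial>distr M (count_space UNIV) b)"
    by (rule integral_distr[symmetric]) auto
  also have "\<dots> = q" unfolding D using q by simp
  finally show "expectation (\<lambda>\<omega>. of_bool (b \<omega>)) = q" .
qed

section \<open>Sigma-algebras generated by sets of sources, and their independence\<close>

definition source_algebra ::
  "'a measure \<Rightarrow> ('a \<Rightarrow> real^'n) \<Rightarrow> (nat \<Rightarrow> 'a \<Rightarrow> real^'n) \<Rightarrow> (nat \<Rightarrow> 'm \<Rightarrow> 'a \<Rightarrow> bool)
    \<Rightarrow> 'm source set \<Rightarrow> 'a measure"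
  where "source_algebra M X0 W v S = sigma (space M) (\<Union>s\<in>S. source_events M X0 W v s)"

lemma source_events_space: "E \<in> source_events M X0 W v s \<Longrightarrow> E \<subseteq> space M"
  by (cases s) auto

lemma space_source_algebra [simp]: "space (source_algebra M X0 W v S) = space M"
  by (simp add: source_algebra_def space_measure_of_conv)

lemma sets_source_algebra:
  "sets (source_algebra M X0 W v S) = sigma_sets (space M) (\<Union>s\<in>S. source_events M X0 W v s)"
  unfolding source_algebra_def by (intro sets_measure_of) (auto dest: source_events_space)

lemma sets_source_algebra_mono:
  "S \<subseteq> T \<Longrightarrow> sets (source_algebra M X0 W v S) \<subseteq> sets (source_algebra M X0 W v T)"
  unfolding sets_source_algebra by (rule sigma_sets_mono') blast

lemma measurable_source_algebra_mono:
  assumes "f \<in> measurable (source_algebra M X0 W v S) N" "S \<subseteq> T"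
  shows "f \<in> measurable (source_algebra M X0 W v T) N"
  by (rule measurable_from_subalg[OF _ assms(1)])
     (simp add: subalgebra_def sets_source_algebra_mono[OF assms(2)])

lemma measurable_source:
  shows measurable_source_Init: "Init \<in> S \<Longrightarrow> X0 \<in> borel_measurable (source_algebra M X0 W v S)"
    and measurable_source_Noise: "Noise j \<in> S \<Longrightarrow> W j \<in> borel_measurable (source_algebra M X0 W v S)"
    and measurable_source_Loss:
      "Loss j i \<in> S \<Longrightarrow> v j i \<in> measurable (source_algebra M X0 W v S) (count_space UNIV)"
proof -
  have *: "E \<in> source_events M X0 W v s \<Longrightarrow> s \<in> S \<Longrightarrow> E \<in> sets (source_algebra M X0 W v S)" for E s
    unfolding sets_source_algebra by (intro sigma_sets.Basic) auto
  show "Init \<in> S \<Longrightarrow> X0 \<in> borel_measurable (source_algebra M X0 W v S)"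
    by (intro measurableI *[of _ Init]) auto
  show "Noise j \<in> S \<Longrightarrow> W j \<in> borel_measurable (source_algebra M X0 W v S)"
    by (intro measurableI *[of _ "Noise j"]) auto
  show "Loss j i \<in> S \<Longrightarrow> v j i \<in> measurable (source_algebra M X0 W v S) (count_space UNIV)"
    by (intro measurableI *[of _ "Loss j i"]) auto
qed

lemma Int_stable_source_events: "Int_stable (source_events M X0 W v s)"
proof (cases s)
  case Init
  have "\<exists>S''. X0 -` S \<inter> space M \<inter> (X0 -` S' \<inter> space M) = X0 -` S'' \<inter> space M \<and> S'' \<in> sets borel"
    if "S \<in> sets borel" "S' \<in> sets borel" for S S'
    using that by (intro exI[of _ "S \<inter> S'"]) auto
  with Init show ?thesis by (auto simp: Int_stable_def)
next
  case (Noise j)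
  have "\<exists>S''. W j -` S \<inter> space M \<inter> (W j -` S' \<inter> space M) = W j -` S'' \<inter> space M \<and> S'' \<in> sets borel"
    if "S \<in> sets borel" "S' \<in> sets borel" for S S'
    using that by (intro exI[of _ "S \<inter> S'"]) auto
  with Noise show ?thesis by (auto simp: Int_stable_def)
next
  case (Loss j i)
  have "\<exists>S''. v j i -` S \<inter> space M \<inter> (v j i -` S' \<inter> space M) = v j i -` S'' \<inter> space M" for S S'
    by (intro exI[of _ "S \<inter> S'"]) auto
  with Loss show ?thesis by (auto simp: Int_stable_def)
qed

lemma (in prob_space) subalgebra_source_algebra:
  assumes "indep_sets (source_events M X0 W v) UNIV"
  shows "subalgebra M (source_algebra M X0 W v S)"
proof -
  have "(\<Union>s\<in>S. source_events M X0 W v s) \<subseteq> events"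
    using assms by (auto simp: indep_sets_def)
  then show ?thesis
    unfolding subalgebra_def sets_source_algebra by (simp add: sets.sigma_sets_subset)
qed

text \<open>Independence of the sources passes to the sigma-algebras of disjoint blocks of them,
  because the generating preimages are closed under intersection. The two blocks are indexed by
  \<open>bool\<close>, and the sigma-algebras of \<open>f\<close> and \<open>g\<close> lie inside
  them.\<close>

lemma (in prob_space) indep_var_source_algebra:
  assumes indep: "indep_sets (source_events M X0 W v) UNIV" and disj: "S \<inter> T = {}"
    and f: "f \<in> borel_measurable (source_algebra M X0 W v S)"
    and g: "g \<in> borel_measurable (source_algebra M X0 W v T)"
  shows "indep_var borel f borel g"
proof -
  let ?E = "source_events M X0 W v"
  have "indep_sets (\<lambda>b. sigma_sets (space M) (\<Union>s\<in>case_bool S T b. ?E s)) UNIV"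
  proof (rule indep_sets_collect_sigma)
    show "indep_sets ?E (\<Union>b\<in>UNIV. case_bool S T b)"
      by (rule indep_sets_mono_index[OF _ indep]) simp
    show "disjoint_family_on (case_bool S T) UNIV"
      using disj by (auto simp: disjoint_family_on_def split: bool.split)
  qed (rule Int_stable_source_events)
  moreover have "sigma_sets (space M) {h -` C \<inter> space M |C. C \<in> sets borel} \<subseteq>
      sigma_sets (space M) (\<Union>s\<in>R. ?E s)"
    if h: "h \<in> borel_measurable (source_algebra M X0 W v R)" for h R
    using measurable_sets[OF h]
    by (intro sigma_sets_mono) (auto simp: sets_source_algebra)
  from this[OF f] this[OF g] have
    "(case b of True \<Rightarrow> sigma_sets (space M) {f -` C \<inter> space M |C. C \<in> sets borel}
       | False \<Rightarrow> sigma_sets (space M) {g -` C \<inter> space M |C. C \<in> sets borel})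
     \<subseteq> sigma_sets (space M) (\<Union>s\<in>case_bool S T b. ?E s)" for b
    by (cases b) auto
  ultimately have "indep_set (sigma_sets (space M) {f -` C \<inter> space M |C. C \<in> sets borel})
      (sigma_sets (space M) {g -` C \<inter> space M |C. C \<in> sets borel})"
    unfolding indep_set_def by (rule indep_sets_mono_sets)
  moreover have "f \<in> borel_measurable M" "g \<in> borel_measurable M"
    using f g subalgebra_source_algebra[OF indep] by (auto intro: measurable_from_subalg)
  ultimately show ?thesis by (simp add: indep_var_eq)
qed

text \<open>Indicators of events of \<open>F\<close> are measurable for the sources in
  \<open>S\<close>, and these are disjoint from the sources behind \<open>Z\<close>. Independence
  from the information is thus settled by inspecting which sources enter a quantity.\<close>

lemma (in prob_space) has_cond_exp_source:
  assumes indep: "indep_sets (source_events M X0 W v) UNIV" and disj: "S \<inter> T = {}"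
    and F: "subalgebra (source_algebra M X0 W v S) F"
    and Z: "Z \<in> borel_measurable (source_algebra M X0 W v T)" and int: "integrable M Z"
  shows "has_cond_exp M F Z (\<lambda>_. expectation Z)"
proof (rule has_cond_exp_indep[OF _ int])
  show "subalgebra M F"
    using F subalgebra_source_algebra[OF indep, of S] by (auto simp: subalgebra_def)
  fix A assume "A \<in> sets F"
  then have "indicator A \<in> borel_measurable (source_algebra M X0 W v S)"
    using F by (intro borel_measurable_indicator) (auto simp: subalgebra_def)
  then show "indep_var borel (indicator A) borel Z"
    using indep_var_source_algebra[OF indep disj] Z by blast
qed

section \<open>The quadratic programme\<close>

lemma inner_matrix_vector_transpose: "x \<bullet> (A *v y) = (transpose A *v x) \<bullet> y" for A :: "real^'n^'m"
  by (simp add: transpose_matrix_vector dot_lmul_matrix)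

lemma inner_vector_matrix: "x \<bullet> (y v* A) = (A *v x) \<bullet> y" for A :: "real^'n^'m"
  by (metis dot_lmul_matrix inner_commute)

lemma inner_matrix_vector_sum: "x \<bullet> (K *v y) = (\<Sum>q\<in>UNIV. \<Sum>r\<in>UNIV. K $ q $ r * (x $ q * y $ r))" for K :: "real^'n^'m"
  by (simp add: inner_vec_def matrix_vector_mult_def sum_distrib_left mult_ac)

lemma diag_mult_vector: "diag d *v x = (\<chi> q. d $ q * x $ q)"
  by (simp add: vec_eq_iff diag_def matrix_vector_mult_def if_distrib[of "\<lambda>a. a * _"] cong: if_cong)

lemma diag_mult_component: "(diag d *v x) $ q = d $ q * x $ q"
  by (simp add: diag_mult_vector)

lemma inner_diag: "x \<bullet> (diag d *v y) = (\<Sum>q\<in>UNIV. d $ q * (x $ q * y $ q))"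
  by (simp add: inner_vec_def diag_mult_vector mult_ac)

lemma inner_diag_swap: "x \<bullet> (diag e *v y) = (diag e *v x) \<bullet> y"
  by (simp add: inner_vec_def diag_mult_vector mult_ac)

lemma is_diagonal_eq: "is_diagonal A \<Longrightarrow> A = diag (\<chi> q. A $ q $ q)"
  by (auto simp: is_diagonal_def diag_def vec_eq_iff)

lemma diag_add: "diag (a + b) = diag a + diag b"
  by (simp add: vec_eq_iff diag_def)

lemma diag_mult_diag: "diag a ** diag b = diag (a * b)"
  by (simp add: vec_eq_iff diag_def matrix_matrix_mult_def if_distrib[of "\<lambda>a. a * _"] cong: if_cong)

lemma positive_definite_diagonal_pos:
  assumes "positive_definite A" shows "0 < A $ q $ q"
proof -
  have "axis q 1 \<bullet> (A *v axis q 1) = A $ q $ q"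
    by (simp add: inner_axis' matrix_vector_mul_component inner_axis)
  then show ?thesis using assms by (metis axis_eq_0_iff positive_definite_def zero_neq_one)
qed

lemma matrix_inv_right_inverse:
  assumes "invertible A" shows "A ** matrix_inv A = mat 1"
  using someI_ex[OF assms[unfolded invertible_def]] unfolding matrix_inv_def by blast

text \<open>The deterministic problem left after conditioning: \<open>m\<close> stands for the loss
  rates repeated over the horizon, \<open>d\<close> for the diagonal input weight with the rates
  factored out.\<close>

locale lossy_quadratic =
  fixes \<Omega> :: "real^'p^'p" and \<Phi> :: "real^'x^'p" and \<Gamma> :: "real^'q^'p" and m d :: "real^'q"
  assumes symmetric: "transpose \<Omega> = \<Omega>" and nonneg: "\<And>y. 0 \<le> y \<bullet> (\<Omega> *v y)"
    and m_pos: "\<And>q. 0 < m $ q" and d_pos: "\<And>q. 0 < d $ q"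
begin

definition "gain = (transpose \<Gamma> ** \<Omega> ** \<Gamma>) ** diag m + diag d"
definition "coupling = transpose \<Gamma> ** \<Omega> ** \<Phi>"
text \<open>The bilinear form of \<open>diag m ** gain\<close>, written so that symmetry and
  positivity are visible although \<open>gain\<close> itself need not be symmetric.\<close>

definition "bil y z = (\<Gamma> *v (diag m *v y)) \<bullet> (\<Omega> *v (\<Gamma> *v (diag m *v z))) + y \<bullet> (diag m *v (diag d *v z))"

lemma bil_gain: "bil y z = y \<bullet> (diag m *v (gain *v z))"
  by (simp add: bil_def gain_def matrix_vector_mult_add_rdistrib matrix_vector_right_distrib inner_add_right
      inner_diag_swap[of y m] inner_vector_matrix
      flip: matrix_vector_mul_assoc)

lemma bil_commute: "bil y z = bil z y"
proof -
  have "a \<bullet> (\<Omega> *v b) = b \<bullet> (\<Omega> *v a)" for a b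
    by (metis inner_commute inner_matrix_vector_transpose symmetric)
  moreover have "y \<bullet> (diag m *v (diag d *v z)) = z \<bullet> (diag m *v (diag d *v y))"
    by (simp add: inner_vec_def diag_mult_vector mult_ac)
  ultimately show ?thesis by (simp add: bil_def)
qed

text \<open>The \<open>\<Omega>\<close> term is only nonnegative, since \<open>\<Gamma>\<close> may
  have a kernel. Strictness comes from the diagonal term at a nonzero coordinate of
  \<open>y\<close>.\<close>

lemma bil_pos: assumes "y \<noteq> 0" shows "0 < bil y y"
proof -
  from assms obtain q where q: "y $ q \<noteq> 0" by (auto simp: vec_eq_iff)
  have "0 < (\<Sum>q\<in>UNIV. m $ q * (y $ q * (d $ q * y $ q)))"
  proof (rule sum_pos2[of _ q])
    have "m $ q * (y $ q * (d $ q * y $ q)) = m $ q * d $ q * (y $ q)\<^sup>2" for q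
      by (simp add: power2_eq_square mult_ac)
    moreover have "0 < m $ q * d $ q * (y $ q)\<^sup>2" using q m_pos d_pos by simp
    moreover have "0 \<le> m $ q * d $ q * (y $ q)\<^sup>2" for q
      using m_pos[of q] d_pos[of q] by simp
    ultimately show "0 < m $ q * (y $ q * (d $ q * y $ q))"
      "\<And>q. 0 \<le> m $ q * (y $ q * (d $ q * y $ q))"
      by metis+
  qed auto
  then show ?thesis
    using nonneg[of "\<Gamma> *v (diag m *v y)"] by (simp add: bil_def inner_diag diag_mult_component)
qed

text \<open>A kernel vector \<open>y\<close> of \<open>gain\<close> satisfies
  \<open>bil y y = 0\<close>, hence vanishes; for a square matrix a left inverse is enough.\<close>

lemma invertible_gain: "invertible gain"
proof -
  have "y = 0" if "gain *v y = 0" for y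
    using bil_pos[of y] that by (cases "y = 0") (simp_all add: bil_gain matrix_vector_mult_0_right)
  then have "\<exists>B. B ** gain = mat 1" unfolding matrix_left_invertible_ker by blast
  then show ?thesis by (simp add: invertible_left_inverse)
qed

definition "minimiser x = - (matrix_inv gain *v (coupling *v x))"

lemma gain_minimiser: "gain *v minimiser x = - (coupling *v x)"
  by (simp add: minimiser_def vec.neg matrix_vector_mul_assoc matrix_mul_assoc matrix_inv_right_inverse invertible_gain)

text \<open>With \<open>z = minimiser x\<close>, the equation
  \<open>gain *v z = - (coupling *v x)\<close> turns the terms linear in \<open>u\<close> into
  \<open>- 2 * bil u z\<close>. Completing the square leaves \<open>- bil z z\<close>, which is the
  subtracted form in \<open>x\<close>.\<close>

lemma complete_square:
  "(\<Phi> *v x + \<Gamma> *v (diag m *v u)) \<bullet> (\<Omega> *v (\<Phi> *v x + \<Gamma> *v (diag m *v u))) + u \<bullet> (diag m *v (diag d *v u))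
   = x \<bullet> ((transpose \<Phi> ** \<Omega> ** \<Phi>) *v x)
     - x \<bullet> ((transpose coupling ** diag m ** matrix_inv gain ** coupling) *v x)
     + bil (u - minimiser x) (u - minimiser x)"
proof -
  let ?z = "minimiser x"
  have cross: "(\<Gamma> *v (diag m *v u)) \<bullet> (\<Omega> *v (\<Phi> *v x)) = - bil u ?z"
    by (simp add: bil_gain gain_minimiser coupling_def vec.neg
      inner_diag_swap[of u m] inner_vector_matrix
      flip: matrix_vector_mul_assoc)
  have cross': "(\<Phi> *v x) \<bullet> (\<Omega> *v (\<Gamma> *v (diag m *v u))) = - bil u ?z"
    unfolding cross[symmetric] by (metis inner_commute inner_matrix_vector_transpose symmetric)
  have px: "x \<bullet> ((transpose \<Phi> ** \<Omega> ** \<Phi>) *v x) = (\<Phi> *v x) \<bullet> (\<Omega> *v (\<Phi> *v x))"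
    by (simp add: inner_vector_matrix flip: matrix_vector_mul_assoc)
  have "bil ?z ?z = - (?z \<bullet> (diag m *v (coupling *v x)))"
    by (simp add: bil_gain gain_minimiser vec.neg)
  also have "\<dots> = x \<bullet> ((transpose coupling ** diag m ** matrix_inv gain ** coupling) *v x)"
    by (simp add: inner_vector_matrix minimiser_def
      inner_commute inner_diag_swap[of "_ *v _"] flip: matrix_vector_mul_assoc)
  finally have zz: "bil ?z ?z = \<dots>" .
  have "bil (u - ?z) (u - ?z) = bil u u - bil u ?z - bil ?z u + bil ?z ?z"
    by (simp add: bil_gain matrix_vector_mult_diff_distrib inner_diff_left inner_diff_right)
  then show ?thesis
    by (simp add: px cross cross' zz[symmetric] bil_commute[of ?z u] matrix_vector_right_distrib
      inner_add_left inner_add_right) (simp add: bil_def)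
qed

end

section \<open>Measurability of vector operations, and the loss matrices in diagonal form\<close>

lemma borel_measurable_matrix_vector_mult:
  fixes A :: "real^'n^'m"
  assumes "f \<in> borel_measurable F"
  shows "(\<lambda>\<omega>. A *v f \<omega>) \<in> borel_measurable F"
  by (rule measurable_compose[OF assms borel_measurable_continuous_onI[OF matrix_vector_mult_linear_continuous_on]])

lemma borel_measurable_vec_nth:
  fixes f :: "'a \<Rightarrow> real^'n"
  assumes "f \<in> borel_measurable F"
  shows "(\<lambda>\<omega>. f \<omega> $ i) \<in> borel_measurable F"
  by (rule measurable_compose[OF assms borel_measurable_continuous_onI]) (intro continuous_intros)

lemma borel_measurable_vec_lambda:
  fixes f :: "'n::finite \<Rightarrow> 'a \<Rightarrow> real"
  assumes "\<And>i. f i \<in> borel_measurable F"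
  shows "(\<lambda>\<omega>. \<chi> i. f i \<omega>) \<in> borel_measurable F"
  unfolding borel_measurable_euclidean_space[of "\<lambda>\<omega>. \<chi> i. f i \<omega>"]
  using assms by (auto simp: Basis_vec_def inner_axis)

lemmas borel_measurable_vec_intros =
  borel_measurable_matrix_vector_mult borel_measurable_vec_nth borel_measurable_vec_lambda

lemma loss_matrix_mult_vector: "loss_matrix v j \<omega> *v x = (\<chi> i. of_bool (v j i \<omega>) * x $ i)"
  by (simp add: loss_matrix_def diag_mult_vector)

lemma Upsilon_eq_diag:
  "(Upsilon v k \<omega> :: real^('h::{finite,linorder} \<times> 'm::finite)^('h \<times> 'm))
    = diag (\<chi> q. of_bool (v (k + block_no (fst q)) (snd q) \<omega>))"
  by (auto simp: Upsilon_def blockdiag_def loss_matrix_def diag_def vec_eq_iff prod_eq_iff)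

lemma kron_diag_eq_diag: "kron (mat 1) (diag \<mu>) = diag (\<chi> q. \<mu> $ snd q)"
  by (auto simp: kron_def mat_def diag_def vec_eq_iff prod_eq_iff)

section \<open>The plant\<close>

text \<open>The plant equation and the past inputs are given up to time \<open>k\<close>. After
  \<open>k\<close>, trajectories come from \<open>rollout\<close> under a candidate input, so that
  ranging over candidates leaves \<open>X\<close> unchanged.\<close>

locale lossy_plant = prob_space M for M :: "'a measure" +
  fixes p :: protocol and A \<Sigma>W :: "real^'n^'n" and B :: "real^'m^'n" and \<mu> :: "real^'m"
    and X W :: "nat \<Rightarrow> 'a \<Rightarrow> real^'n" and v :: "nat \<Rightarrow> 'm \<Rightarrow> 'a \<Rightarrow> bool"
    and U :: "nat \<Rightarrow> 'a \<Rightarrow> real^'m" and k :: nat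
  assumes noise_cov: "positive_definite \<Sigma>W" and noise: "\<And>j. gaussian M (W j) 0 \<Sigma>W"
    and loss_rate: "\<And>i. 0 \<le> \<mu> $ i" "\<And>i. \<mu> $ i \<le> 1" and loss: "\<And>j i. bernoulli M (v j i) (\<mu> $ i)"
    and indep: "indep_sets (source_events M (X 0) W v) UNIV"
    and past_inputs: "\<And>j. j < k \<Longrightarrow> U j \<in> borel_measurable (info p M X v j)"
    and plant: "\<And>j \<omega>. j < k \<Longrightarrow> \<omega> \<in> space M \<Longrightarrow>
      X (Suc j) \<omega> = A *v X j \<omega> + B *v (loss_matrix v j \<omega> *v U j \<omega>) + W j \<omega>"
begin

section \<open>Dependence of states and information on the sources\<close>

abbreviation src :: "'m source set \<Rightarrow> 'a measure"
  where "src \<equiv> source_algebra M (X 0) W v"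

text \<open>\<open>X j\<close> is driven by noise and losses of index at most \<open>j - 1\<close>;
  those at time \<open>j\<close> first act on the next state. Hence the strict inequalities, which
  leave time \<open>k\<close> itself to \<open>future\<close>.\<close>

definition past :: "nat \<Rightarrow> 'm source set"
  where "past j = insert Init ({Noise i |i. i < j} \<union> {Loss i l |i l. i < j})"

lemma subalgebra_srcI:
  assumes "E \<subseteq> sets (src S)" shows "subalgebra (src S) (sigma (space M) E)"
proof -
  have "E \<subseteq> Pow (space M)" using assms sets.sets_into_space[of _ "src S"] by auto
  then show ?thesis
    using sets.sigma_sets_subset[OF assms] by (simp add: subalgebra_def space_measure_of_conv)
qed

lemma state_events_src:
  assumes "\<And>i. i \<le> j \<Longrightarrow> X i \<in> borel_measurable (src S)"
  shows "state_events M X j \<subseteq> sets (src S)"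
proof
  fix E assume "E \<in> state_events M X j"
  then obtain i S' where "E = X i -` S' \<inter> space M" "i \<le> j" "S' \<in> sets borel"
    by (auto simp: state_events_def)
  then show "E \<in> sets (src S)" using measurable_sets[OF assms[of i], of S'] by simp
qed

lemma loss_events_src:
  assumes "\<And>i l. i < j \<Longrightarrow> Loss i l \<in> S"
  shows "loss_events M v j \<subseteq> sets (src S)"
proof
  fix E assume "E \<in> loss_events M v j"
  then obtain i l S' where "E = v i l -` S' \<inter> space M" "i < j"
    by (auto simp: loss_events_def)
  then show "E \<in> sets (src S)"
    using measurable_sets[OF measurable_source_Loss[OF assms[of i l]], of S'] by simp
qed

lemma subalgebra_src_info:
  assumes "\<And>i. i \<le> j \<Longrightarrow> X i \<in> borel_measurable (src S)" "\<And>i l. i < j \<Longrightarrow> Loss i l \<in> S"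
  shows "subalgebra (src S) (info q M X v j)"
  using state_events_src[of j S] loss_events_src[of j S] assms
  by (cases q) (auto intro!: subalgebra_srcI)

text \<open>The feedback loop is resolved by strong induction: the input at time \<open>i\<close> is
  measurable for information generated by states up to \<open>i\<close>, which the induction
  hypothesis expresses through earlier sources, and, under TCP, by losses before \<open>i\<close>,
  which are sources themselves.\<close>

lemma measurable_state_past: "j \<le> k \<Longrightarrow> X j \<in> borel_measurable (src (past j))"
proof (induction j rule: less_induct)
  case (less j)
  show ?case
  proof (cases j)
    case 0
    then show ?thesis by (auto intro: measurable_source_Init simp: past_def)
  next
    case (Suc i)
    have mono: "past i' \<subseteq> past j" if "i' \<le> j" for i'
      using that by (auto simp: past_def)
    have X: "X i' \<in> borel_measurable (src (past j))" if "i' \<le> i" for i'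
      using less.IH[of i'] less.prems that Suc mono[of i'] by (auto intro: measurable_source_algebra_mono)
    have "subalgebra (src (past j)) (info p M X v i)"
      using X Suc by (intro subalgebra_src_info) (auto simp: past_def)
    then have U: "U i \<in> borel_measurable (src (past j))"
      using past_inputs[of i] less.prems Suc by (auto intro: measurable_from_subalg)
    have L: "v i l \<in> measurable (src (past j)) (count_space UNIV)" for l
      using Suc by (intro measurable_source_Loss) (auto simp: past_def)
    have W: "W i \<in> borel_measurable (src (past j))"
      using Suc by (intro measurable_source_Noise) (auto simp: past_def)
    have "(\<lambda>\<omega>. of_bool (v i l \<omega>) :: real) \<in> borel_measurable (src (past j))" for l
      by (rule measurable_compose[OF L]) simp
    then have "(\<lambda>\<omega>. A *v X i \<omega> + B *v (loss_matrix v i \<omega> *v U i \<omega>) + W i \<omega>) \<in> borel_measurable (src (past j))"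
      unfolding loss_matrix_mult_vector
      by (intro borel_measurable_add borel_measurable_vec_intros borel_measurable_times X U W order_refl)
    then show ?thesis
      using plant[of i] Suc less.prems by (subst measurable_cong) auto
  qed
qed

lemma subalgebra_past_info: "subalgebra (src (past k)) (info p M X v k)"
proof (rule subalgebra_src_info)
  fix i assume "i \<le> k"
  then show "X i \<in> borel_measurable (src (past k))"
    by (intro measurable_source_algebra_mono[OF measurable_state_past[of i]]) (auto simp: past_def)
qed (auto simp: past_def)

text \<open>The TCP error conditions on the losses over the horizon but on no noise from time
  \<open>k\<close> on, so the noise still averages out.\<close>

lemma subalgebra_err_info_TCP:
  "subalgebra (src (past k \<union> {Loss j l |j l. j < k + N})) (err_info TCP M X v k N)"
  unfolding err_info.simps
proof (intro subalgebra_srcI Un_least state_events_src loss_events_src)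
  fix i assume "i \<le> k"
  then show "X i \<in> borel_measurable (src (past k \<union> {Loss j l |j l. j < k + N}))"
    by (intro measurable_source_algebra_mono[OF measurable_state_past[of i]]) (auto simp: past_def)
qed auto

lemma subalgebra_src: "subalgebra M (src S)"
  by (rule subalgebra_source_algebra[OF indep])

lemma subalgebra_info: "subalgebra M (info p M X v k)"
  using subalgebra_past_info subalgebra_src[of "past k"] by (auto simp: subalgebra_def)

lemma measurable_state_info: "X k \<in> borel_measurable (info p M X v k)"
proof (rule measurableI)
  fix S :: "(real^'n) set" assume S: "S \<in> sets borel"
  have sub: "state_events M X k \<union> loss_events M v k \<subseteq> Pow (space M)"
    by (auto simp: state_events_def loss_events_def)
  have "X k -` S \<inter> space M \<in> state_events M X k"
    using S unfolding state_events_def by blast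
  then have "X k -` S \<inter> space M \<in> sets (info p M X v k)"
    using sub by (cases p) auto
  then show "X k -` S \<inter> space (info p M X v k) \<in> sets (info p M X v k)"
    using subalgebra_info by (simp add: subalgebra_def)
qed simp

lemma info_le_err_info: "subalgebra (err_info TCP M X v k N) (info TCP M X v k)"
proof -
  have sub: "state_events M X k \<union> loss_events M v j \<subseteq> Pow (space M)" for j
    by (auto simp: state_events_def loss_events_def)
  have "loss_events M v k \<subseteq> loss_events M v (k + N)"
    by (force simp: loss_events_def)
  then have "sigma_sets (space M) (state_events M X k \<union> loss_events M v k)
      \<subseteq> sigma_sets (space M) (state_events M X k \<union> loss_events M v (k + N))"
    by (intro sigma_sets_mono') auto
  then show ?thesis
    by (simp add: subalgebra_def space_measure_of_conv sets_measure_of[OF sub])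
qed

lemma measurable_loss_err_info:
  assumes "j < k + N"
  shows "v j i \<in> measurable (err_info TCP M X v k N) (count_space UNIV)"
proof (rule measurableI)
  fix S :: "bool set"
  have "state_events M X k \<union> loss_events M v (k + N) \<subseteq> Pow (space M)"
    by (auto simp: state_events_def loss_events_def)
  moreover have "v j i -` S \<inter> space M \<in> loss_events M v (k + N)"
    using assms unfolding loss_events_def by blast
  ultimately show "v j i -` S \<inter> space (err_info TCP M X v k N) \<in> sets (err_info TCP M X v k N)"
    by (auto simp: space_measure_of_conv)
qed simp

subsection \<open>Future noise and losses\<close>

text \<open>Real coordinates, each read off a single source, so that conditional expectations and
  covariances can be computed entry by entry.\<close>

definition noise_entry :: "'h::{finite,linorder} \<times> 'n \<Rightarrow> 'a \<Rightarrow> real"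
  where "noise_entry r \<omega> = W (k + block_no (fst r)) \<omega> $ snd r"

definition loss_entry :: "'h::{finite,linorder} \<times> 'm \<Rightarrow> 'a \<Rightarrow> real"
  where "loss_entry q \<omega> = of_bool (v (k + block_no (fst q)) (snd q) \<omega>)"

abbreviation noise_source :: "'h::{finite,linorder} \<times> 'n \<Rightarrow> 'm source"
  where "noise_source r \<equiv> Noise (k + block_no (fst r))"

abbreviation loss_source :: "'h::{finite,linorder} \<times> 'm \<Rightarrow> 'm source"
  where "loss_source q \<equiv> Loss (k + block_no (fst q)) (snd q)"

lemma measurable_noise_entry: "noise_source r \<in> S \<Longrightarrow> noise_entry r \<in> borel_measurable (src S)"
  unfolding noise_entry_def[abs_def] by (intro borel_measurable_vec_nth measurable_source_Noise)

lemma measurable_loss_entry: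
  assumes "loss_source q \<in> S" shows "loss_entry q \<in> borel_measurable (src S)"
  unfolding loss_entry_def[abs_def]
  by (rule measurable_compose[OF measurable_source_Loss[where v=v, OF assms]]) simp

lemma noise_entry_mean:
  "integrable M (noise_entry r)" "expectation (noise_entry r) = 0"
  using gaussian_second_moment(1,2)[OF noise_cov noise, of "axis (snd r) 1" "k + block_no (fst r)"]
  by (simp_all add: noise_entry_def[abs_def] inner_axis')

lemma loss_entry_mean:
  "integrable M (loss_entry q)" "expectation (loss_entry q) = \<mu> $ snd q"
  using bernoulli_moment[OF loss loss_rate, of "k + block_no (fst q)" "snd q"]
  by (simp_all add: loss_entry_def[abs_def])

text \<open>Within a block this is the Gaussian covariance. Entries of different blocks come from
  distinct sources, as \<open>block_no\<close> is injective, so their product has mean 0. This is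
  the zero pattern of the Kronecker product.\<close>

lemma noise_entry_covariance:
  "integrable M (\<lambda>\<omega>. noise_entry q \<omega> * noise_entry r \<omega>)"
  "expectation (\<lambda>\<omega>. noise_entry q \<omega> * noise_entry r \<omega>) = kron (mat 1) \<Sigma>W $ q $ r"
proof -
  have "integrable M (\<lambda>\<omega>. noise_entry q \<omega> * noise_entry r \<omega>) \<and>
    expectation (\<lambda>\<omega>. noise_entry q \<omega> * noise_entry r \<omega>) = kron (mat 1) \<Sigma>W $ q $ r"
  proof (cases "fst q = fst r")
    case True
    then show ?thesis
      using centered_gaussian_covariance[OF noise_cov noise, of "k + block_no (fst r)" "snd q" "snd r"]
      by (simp add: noise_entry_def kron_def mat_def)
  next
    case False
    then have "indep_var borel (noise_entry q) borel (noise_entry r)"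
      by (intro indep_var_source_algebra[OF indep, of "{noise_source q}" "{noise_source r}"])
         (auto simp: measurable_noise_entry dest: injD[OF inj_block_no])
    from indep_var_lebesgue_integral[OF this] indep_var_integrable[OF this] False
    show ?thesis by (simp add: noise_entry_mean kron_def mat_def)
  qed
  then show "integrable M (\<lambda>\<omega>. noise_entry q \<omega> * noise_entry r \<omega>)"
    "expectation (\<lambda>\<omega>. noise_entry q \<omega> * noise_entry r \<omega>) = kron (mat 1) \<Sigma>W $ q $ r" by auto
qed

abbreviation loss_deviation :: "'h::{finite,linorder} \<times> 'm \<Rightarrow> 'a \<Rightarrow> real"
  where "loss_deviation q \<omega> \<equiv> loss_entry q \<omega> - \<mu> $ snd q"

lemma loss_deviation_mean:
  "integrable M (loss_deviation q)" "expectation (loss_deviation q) = 0"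
  by (simp_all add: loss_entry_mean prob_space)

lemma measurable_loss_deviation:
  "loss_source q \<in> S \<Longrightarrow> loss_deviation q \<in> borel_measurable (src S)"
  by (intro borel_measurable_diff measurable_loss_entry) auto

lemma loss_deviation_covariance:
  "integrable M (\<lambda>\<omega>. loss_deviation q \<omega> * loss_deviation r \<omega>)"
  "expectation (\<lambda>\<omega>. loss_deviation q \<omega> * loss_deviation r \<omega>)
    = (if q = r then \<mu> $ snd q * (1 - \<mu> $ snd q) else 0)"
proof -
  have "integrable M (\<lambda>\<omega>. loss_deviation q \<omega> * loss_deviation r \<omega>) \<and>
    expectation (\<lambda>\<omega>. loss_deviation q \<omega> * loss_deviation r \<omega>)
      = (if q = r then \<mu> $ snd q * (1 - \<mu> $ snd q) else 0)"
  proof (cases "q = r")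
    case True
    \<comment> \<open>The entry is 0 or 1 and equals its square. The squared deviation is therefore
      affine in it, and the first moment suffices.\<close>
    have "loss_deviation q \<omega> * loss_deviation r \<omega>
        = (1 - 2 * \<mu> $ snd q) * loss_entry q \<omega> + (\<mu> $ snd q)\<^sup>2" for \<omega>
      by (simp add: True loss_entry_def power2_eq_square algebra_simps)
    then show ?thesis
      using True by (simp only: loss_entry_mean prob_space) (simp add: loss_entry_mean prob_space power2_eq_square algebra_simps)
  next
    case False
    then have "loss_source q \<noteq> loss_source r"
      by (auto simp: prod_eq_iff dest: injD[OF inj_block_no])
    then have "indep_var borel (loss_deviation q) borel (loss_deviation r)"
      by (intro indep_var_source_algebra[OF indep, of "{loss_source q}" "{loss_source r}"]
          measurable_loss_deviation) auto
    from indep_var_lebesgue_integral[OF this] indep_var_integrable[OF this] False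
    show ?thesis by (simp only: loss_deviation_mean) simp
  qed
  then show "integrable M (\<lambda>\<omega>. loss_deviation q \<omega> * loss_deviation r \<omega>)"
    "expectation (\<lambda>\<omega>. loss_deviation q \<omega> * loss_deviation r \<omega>)
    = (if q = r then \<mu> $ snd q * (1 - \<mu> $ snd q) else 0)" by auto
qed

lemma loss_noise_uncorrelated:
  "integrable M (\<lambda>\<omega>. loss_deviation q \<omega> * noise_entry r \<omega>)"
  "expectation (\<lambda>\<omega>. loss_deviation q \<omega> * noise_entry r \<omega>) = 0"
proof -
  have "indep_var borel (loss_deviation q) borel (noise_entry r)"
    by (intro indep_var_source_algebra[OF indep, of "{loss_source q}" "{noise_source r}"]
        measurable_loss_deviation measurable_noise_entry) auto
  from indep_var_lebesgue_integral[OF this] indep_var_integrable[OF this]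
  show "integrable M (\<lambda>\<omega>. loss_deviation q \<omega> * noise_entry r \<omega>)"
    "expectation (\<lambda>\<omega>. loss_deviation q \<omega> * noise_entry r \<omega>) = 0"
    unfolding loss_deviation_mean noise_entry_mean by (simp_all add: noise_entry_mean loss_deviation_mean(1))
qed

abbreviation future :: "'m source set"
  where "future \<equiv> {Noise j |j. k \<le> j} \<union> {Loss j l |j l. k \<le> j}"

text \<open>\<open>past k\<close> and \<open>future\<close> share no source, and the information
  lies in the sigma-algebra of \<open>past k\<close>. Once factors known at time \<open>k\<close>
  are pulled out, the random terms of the cost reduce to this case.\<close>

lemma has_cond_exp_future:
  assumes "Z \<in> borel_measurable (src future)" "integrable M Z" "expectation Z = e"
  shows "has_cond_exp M (info p M X v k) Z (\<lambda>_. e)"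
proof -
  have "past k \<inter> future = {}" by (auto simp: past_def)
  from has_cond_exp_source[OF indep this subalgebra_past_info assms(1,2)] assms(3) show ?thesis
    by simp
qed

subsection \<open>Conditional expectation of the cost\<close>

definition stacked_noise :: "'a \<Rightarrow> real^('h::{finite,linorder} \<times> 'n)"
  where "stacked_noise \<omega> = stack (\<lambda>h. W (k + block_no h) \<omega>)"

lemma stacked_noise_component [simp]: "stacked_noise \<omega> $ r = noise_entry r \<omega>"
  by (simp add: stacked_noise_def stack_def noise_entry_def)

text \<open>The vector \<open>(Upsilon - Ub) u\<close>, the gap between the input that reaches the
  plant and its prediction: linear in the centred losses, with coefficients known at time
  \<open>k\<close>.\<close>

definition input_deviation ::
  "('a \<Rightarrow> real^('h::{finite,linorder} \<times> 'm)) \<Rightarrow> 'a \<Rightarrow> real^('h \<times> 'm)"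
  where "input_deviation u \<omega> = (\<chi> q. loss_deviation q \<omega> * u \<omega> $ q)"

lemma input_deviation_component [simp]: "input_deviation u \<omega> $ q = loss_deviation q \<omega> * u \<omega> $ q"
  by (simp add: input_deviation_def)

lemma measurable_noise_entry_M: "noise_entry r \<in> borel_measurable M"
  by (rule borel_measurable_integrable[OF noise_entry_mean(1)])

lemma measurable_stacked_noise:
  "(stacked_noise :: 'a \<Rightarrow> real^('h::{finite,linorder} \<times> 'n)) \<in> borel_measurable M"
proof -
  have "(stacked_noise :: 'a \<Rightarrow> real^('h \<times> 'n)) = (\<lambda>\<omega>. \<chi> r. noise_entry r \<omega>)" by (simp add: fun_eq_iff vec_eq_iff)
  then show ?thesis by (simp add: borel_measurable_vec_lambda measurable_noise_entry_M)
qed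

lemma measurable_input_deviation:
  assumes "u \<in> borel_measurable M" shows "input_deviation u \<in> borel_measurable M"
  unfolding input_deviation_def[abs_def]
  by (intro borel_measurable_vec_intros borel_measurable_times assms
      borel_measurable_integrable[OF loss_deviation_mean(1)])

text \<open>\<open>E\<close> is kept general to serve both error terms: the sources \<open>S\<close>
  behind it may include future losses, as under TCP, provided that no noise from time
  \<open>k\<close> on is among them.\<close>

lemma has_cond_exp_noise:
  fixes K :: "real^('h::{finite,linorder} \<times> 'n)^'d"
  assumes E: "subalgebra (src S) E" and S: "S \<inter> {Noise j |j. k \<le> j} = {}"
  shows "has_cond_exp M E (\<lambda>\<omega>. (K *v stacked_noise \<omega>) $ i) (\<lambda>_. 0)"
proof -
  have sub: "subalgebra M E" using E subalgebra_src[of S] by (auto simp: subalgebra_def)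
  interpret E: finite_measure_subalgebra M E by unfold_locales (rule sub)
  have "has_cond_exp M E (noise_entry r) (\<lambda>_. 0)" for r :: "'h \<times> 'n"
    using has_cond_exp_source[OF indep S E measurable_noise_entry noise_entry_mean(1), of r]
    by (simp only: noise_entry_mean) auto
  then have "has_cond_exp M E (\<lambda>\<omega>. \<Sum>r\<in>UNIV. K $ i $ r * noise_entry r \<omega>) (\<lambda>_. \<Sum>r\<in>UNIV. K $ i $ r * 0)"
    by (intro E.has_cond_exp_sum E.has_cond_exp_mult) auto
  then show ?thesis by (simp add: matrix_vector_mult_def)
qed

lemma vec_cond_exp_eqI:
  fixes f c :: "'a \<Rightarrow> real^'d"
  assumes sub: "subalgebra M E" and "\<And>i. has_cond_exp M E (\<lambda>\<omega>. f \<omega> $ i) (\<lambda>\<omega>. c \<omega> $ i)"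
  shows "AE \<omega> in M. vec_cond_exp M E f \<omega> = c \<omega>"
proof -
  interpret E: finite_measure_subalgebra M E by unfold_locales (rule sub)
  have "AE \<omega> in M. \<forall>i. real_cond_exp M E (\<lambda>\<omega>. f \<omega> $ i) \<omega> = c \<omega> $ i"
    using E.has_cond_exp_imp_eq[OF assms(2)] by (intro eventually_all_finite) auto
  then show ?thesis by eventually_elim (simp add: vec_cond_exp_def vec_eq_iff)
qed

section \<open>The stacked trajectory and its error under each protocol\<close>

lemma Upsilon_deviation:
  "Upsilon v k \<omega> *v u \<omega> = kron (mat 1) (diag \<mu>) *v u \<omega> + input_deviation u \<omega>"
  by (simp add: vec_eq_iff Upsilon_eq_diag kron_diag_eq_diag diag_mult_component loss_entry_def algebra_simps)

lemma stacked_state_deviation: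
  "stacked_state A B X W v k u \<omega> = predicted A B \<mu> (X k \<omega>) (u \<omega>)
    + Gamma_mat A B *v input_deviation u \<omega> + Lambda_mat A *v stacked_noise \<omega>"
  unfolding stacked_state_eq Upsilon_deviation predicted_def stacked_noise_def
  by (simp add: matrix_vector_right_distrib)

lemma measurable_predicted:
  assumes "X k \<in> borel_measurable F" "u \<in> borel_measurable F"
  shows "(\<lambda>\<omega>. predicted A B \<mu> (X k \<omega>) (u \<omega>)) \<in> borel_measurable F"
  unfolding predicted_def by (intro borel_measurable_add borel_measurable_vec_intros assms)

text \<open>With the losses over the horizon known, the state and input contributions are measurable
  for the conditioning sigma-algebra and cancel. Only the noise, of conditional mean zero,
  remains.\<close>

lemma err_TCP:
  fixes u :: "'a \<Rightarrow> real^('h::{finite,linorder} \<times> 'm)"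
  assumes p: "p = TCP" and u: "u \<in> borel_measurable (info p M X v k)"
  shows "AE \<omega> in M. err TCP M A B X W v k u \<omega> = Lambda_mat A *v stacked_noise \<omega>"
proof -
  let ?E = "err_info TCP M X v k CARD('h)"
  note S = subalgebra_err_info_TCP[of "CARD('h)"]
  have sub: "subalgebra M ?E"
    using S subalgebra_src[of "past k \<union> {Loss j l |j l. j < k + CARD('h)}"] by (auto simp: subalgebra_def)
  interpret E: finite_measure_subalgebra M ?E by unfold_locales (rule sub)
  define c where "c \<omega> = Phi_mat A *v X k \<omega> + Gamma_mat A B *v (Upsilon v k \<omega> *v u \<omega>)" for \<omega>
  have le: "f \<in> borel_measurable (info p M X v k) \<Longrightarrow> f \<in> borel_measurable ?E" for f :: "'a \<Rightarrow> real^'e"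
    using info_le_err_info p by (auto intro: measurable_from_subalg)
  have L: "loss_entry q \<in> borel_measurable ?E" for q :: "'h \<times> 'm"
    unfolding loss_entry_def[abs_def]
    \<comment> \<open>Block numbers are below \<open>CARD('h)\<close>, so every loss index of the
      horizon is below \<open>k + N\<close>.\<close>
    by (rule measurable_compose[OF measurable_loss_err_info])
       (use bij_betwE[OF bij_block_no[where 'h='h]] in auto)
  have "c \<in> borel_measurable ?E"
    unfolding c_def[abs_def] Upsilon_eq_diag diag_mult_vector vec_lambda_beta loss_entry_def[symmetric]
    by (intro borel_measurable_add borel_measurable_vec_intros borel_measurable_times L
        le[OF u] le[OF measurable_state_info])
  then have "has_cond_exp M ?E (\<lambda>\<omega>. c \<omega> $ i) (\<lambda>\<omega>. c \<omega> $ i)" for i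
    by (intro E.has_cond_exp_F_meas borel_measurable_vec_nth)
  moreover have "has_cond_exp M ?E (\<lambda>\<omega>. (Lambda_mat A *v (stacked_noise \<omega> :: real^('h \<times> 'n))) $ i) (\<lambda>_. 0)" for i
    by (rule has_cond_exp_noise[OF S]) (auto simp: past_def)
  ultimately have "has_cond_exp M ?E (\<lambda>\<omega>. c \<omega> $ i
      + (Lambda_mat A *v (stacked_noise \<omega> :: real^('h \<times> 'n))) $ i) (\<lambda>\<omega>. c \<omega> $ i + 0)" for i
    by (intro E.has_cond_exp_add)
  then have "has_cond_exp M ?E (\<lambda>\<omega>. stacked_state A B X W v k u \<omega> $ i) (\<lambda>\<omega>. c \<omega> $ i)" for i
    by (simp add: stacked_state_eq c_def stacked_noise_def)
  from vec_cond_exp_eqI[OF sub this] show ?thesis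
  proof eventually_elim
    case (elim \<omega>)
    then have "err TCP M A B X W v k u \<omega> = stacked_state A B X W v k u \<omega> - c \<omega>"
      by (simp add: err_def)
    then show ?case by (simp add: stacked_state_eq c_def stacked_noise_def)
  qed
qed

lemma has_cond_exp_input_deviation:
  fixes K :: "real^('h::{finite,linorder} \<times> 'm)^'d"
  assumes u: "u \<in> borel_measurable (info p M X v k)"
  shows "has_cond_exp M (info p M X v k) (\<lambda>\<omega>. (K *v input_deviation u \<omega>) $ i) (\<lambda>_. 0)"
proof -
  interpret F: finite_measure_subalgebra M "info p M X v k" by unfold_locales (rule subalgebra_info)
  have "has_cond_exp M (info p M X v k) (loss_deviation q) (\<lambda>_. 0)" for q :: "'h \<times> 'm"
    by (intro has_cond_exp_future measurable_loss_deviation loss_deviation_mean) auto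
  then have "has_cond_exp M (info p M X v k)
      (\<lambda>\<omega>. \<Sum>q\<in>UNIV. (K $ i $ q * u \<omega> $ q) * loss_deviation q \<omega>) (\<lambda>\<omega>. \<Sum>q\<in>UNIV. (K $ i $ q * u \<omega> $ q) * 0)"
    by (intro F.has_cond_exp_sum F.has_cond_exp_mult borel_measurable_times borel_measurable_vec_nth u) auto
  then show ?thesis by (simp add: matrix_vector_mult_def mult_ac)
qed

text \<open>Here the losses over the horizon stay unknown. The conditional mean is the predicted
  trajectory, and the loss deviations survive in the error beside the noise.\<close>

lemma err_UDP:
  fixes u :: "'a \<Rightarrow> real^('h::{finite,linorder} \<times> 'm)"
  assumes p: "p = UDP" and u: "u \<in> borel_measurable (info p M X v k)"
  shows "AE \<omega> in M. err UDP M A B X W v k u \<omega>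
    = Gamma_mat A B *v input_deviation u \<omega> + Lambda_mat A *v stacked_noise \<omega>"
proof -
  let ?F = "info p M X v k"
  interpret F: finite_measure_subalgebra M ?F by unfold_locales (rule subalgebra_info)
  define c where "c \<omega> = predicted A B \<mu> (X k \<omega>) (u \<omega>)" for \<omega>
  have "c \<in> borel_measurable ?F"
    unfolding c_def[abs_def] by (intro measurable_predicted measurable_state_info u)
  then have "has_cond_exp M ?F (\<lambda>\<omega>. c \<omega> $ i) (\<lambda>\<omega>. c \<omega> $ i)" for i
    by (intro F.has_cond_exp_F_meas borel_measurable_vec_nth)
  moreover have "has_cond_exp M ?F (\<lambda>\<omega>. (Lambda_mat A *v (stacked_noise \<omega> :: real^('h \<times> 'n))) $ i) (\<lambda>_. 0)" for i
    by (rule has_cond_exp_noise[OF subalgebra_past_info]) (auto simp: past_def)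
  ultimately have "has_cond_exp M ?F (\<lambda>\<omega>. c \<omega> $ i + (Gamma_mat A B *v input_deviation u \<omega>) $ i
      + (Lambda_mat A *v (stacked_noise \<omega> :: real^('h \<times> 'n))) $ i) (\<lambda>\<omega>. c \<omega> $ i + 0 + 0)" for i
    by (intro F.has_cond_exp_add has_cond_exp_input_deviation u)
  then have "has_cond_exp M ?F (\<lambda>\<omega>. stacked_state A B X W v k u \<omega> $ i) (\<lambda>\<omega>. c \<omega> $ i)" for i
    by (simp add: stacked_state_deviation c_def)
  from vec_cond_exp_eqI[OF subalgebra_info this] show ?thesis
  proof eventually_elim
    case (elim \<omega>)
    then have "err UDP M A B X W v k u \<omega> = stacked_state A B X W v k u \<omega> - c \<omega>"
      by (simp add: err_def p)
    then show ?case by (simp add: stacked_state_deviation c_def)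
  qed
qed

section \<open>Conditional second moments and the conditional cost\<close>

lemma has_cond_exp_noise_quadratic:
  fixes K :: "real^('h::{finite,linorder} \<times> 'n)^('h \<times> 'n)"
  shows "has_cond_exp M (info p M X v k) (\<lambda>\<omega>. stacked_noise \<omega> \<bullet> (K *v stacked_noise \<omega>))
    (\<lambda>_. trace (kron (mat 1) \<Sigma>W ** K))"
proof -
  interpret F: finite_measure_subalgebra M "info p M X v k" by unfold_locales (rule subalgebra_info)
  let ?S = "kron (mat 1) \<Sigma>W :: real^('h \<times> 'n)^('h \<times> 'n)"
  have "has_cond_exp M (info p M X v k) (\<lambda>\<omega>. noise_entry q \<omega> * noise_entry r \<omega>) (\<lambda>_. ?S $ q $ r)"
    for q r :: "'h \<times> 'n"
    by (intro has_cond_exp_future borel_measurable_times measurable_noise_entry noise_entry_covariance) auto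
  then have "has_cond_exp M (info p M X v k)
      (\<lambda>\<omega>. \<Sum>q\<in>UNIV. \<Sum>r\<in>UNIV. K $ q $ r * (noise_entry q \<omega> * noise_entry r \<omega>))
      (\<lambda>_. \<Sum>q\<in>UNIV. \<Sum>r\<in>UNIV. K $ q $ r * ?S $ q $ r)"
    by (intro F.has_cond_exp_sum F.has_cond_exp_mult) auto
  \<comment> \<open>The trace pairs \<open>?S $ r $ q\<close> with \<open>K $ q $ r\<close>;
    symmetry of the noise covariance exchanges the indices.\<close>
  moreover have "(\<Sum>q\<in>UNIV. \<Sum>r\<in>UNIV. K $ q $ r * ?S $ q $ r) = trace (?S ** K)"
  proof -
    have "\<Sigma>W $ a $ b = \<Sigma>W $ b $ a" for a b
      using noise_cov unfolding positive_definite_def by (metis transpose_def vec_lambda_beta)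
    then have "?S $ q $ r = ?S $ r $ q" for q r by (simp add: kron_def mat_def)
    then have "(\<Sum>q\<in>UNIV. \<Sum>r\<in>UNIV. K $ q $ r * ?S $ q $ r) = (\<Sum>q\<in>UNIV. \<Sum>r\<in>UNIV. ?S $ r $ q * K $ q $ r)"
      by (intro sum.cong refl) (simp add: mult.commute)
    also have "\<dots> = trace (?S ** K)"
      unfolding trace_def matrix_matrix_mult_def by (subst sum.swap) simp
    finally show ?thesis .
  qed
  ultimately show ?thesis by (simp add: inner_matrix_vector_sum)
qed

text \<open>Distinct losses are uncorrelated, so only the diagonal of \<open>K\<close> survives,
  weighted by the loss variances. With \<open>\<Omega>g\<close> for \<open>K\<close> this is the
  origin of the Hadamard term in the UDP gain.\<close>

lemma has_cond_exp_deviation_quadratic: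
  fixes K :: "real^('h::{finite,linorder} \<times> 'm)^('h \<times> 'm)"
  assumes u: "u \<in> borel_measurable (info p M X v k)"
  shows "has_cond_exp M (info p M X v k) (\<lambda>\<omega>. input_deviation u \<omega> \<bullet> (K *v input_deviation u \<omega>))
    (\<lambda>\<omega>. \<Sum>q\<in>UNIV. K $ q $ q * (1 - \<mu> $ snd q) * \<mu> $ snd q * (u \<omega> $ q)\<^sup>2)"
proof -
  interpret F: finite_measure_subalgebra M "info p M X v k" by unfold_locales (rule subalgebra_info)
  let ?c = "\<lambda>q r. if q = r then \<mu> $ snd q * (1 - \<mu> $ snd q) else 0"
  have "has_cond_exp M (info p M X v k) (\<lambda>\<omega>. loss_deviation q \<omega> * loss_deviation r \<omega>) (\<lambda>_. ?c q r)"
    for q r :: "'h \<times> 'm"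
    by (intro has_cond_exp_future borel_measurable_times measurable_loss_deviation loss_deviation_covariance) auto
  then have "has_cond_exp M (info p M X v k)
      (\<lambda>\<omega>. \<Sum>q\<in>UNIV. \<Sum>r\<in>UNIV. (K $ q $ r * (u \<omega> $ q * u \<omega> $ r)) * (loss_deviation q \<omega> * loss_deviation r \<omega>))
      (\<lambda>\<omega>. \<Sum>q\<in>UNIV. \<Sum>r\<in>UNIV. (K $ q $ r * (u \<omega> $ q * u \<omega> $ r)) * ?c q r)"
    by (intro F.has_cond_exp_sum F.has_cond_exp_mult borel_measurable_times borel_measurable_vec_nth u) auto
  then show ?thesis
    by (simp add: inner_matrix_vector_sum mult_ac power2_eq_square if_distrib[of "\<lambda>a. _ * a"] cong: if_cong)
qed

lemma has_cond_exp_deviation_noise: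
  fixes K :: "real^('h::{finite,linorder} \<times> 'n)^('h \<times> 'm)"
  assumes u: "u \<in> borel_measurable (info p M X v k)"
  shows "has_cond_exp M (info p M X v k) (\<lambda>\<omega>. input_deviation u \<omega> \<bullet> (K *v stacked_noise \<omega>)) (\<lambda>\<omega>. 0)"
proof -
  interpret F: finite_measure_subalgebra M "info p M X v k" by unfold_locales (rule subalgebra_info)
  have "has_cond_exp M (info p M X v k) (\<lambda>\<omega>. loss_deviation q \<omega> * noise_entry r \<omega>) (\<lambda>_. 0)"
    for q :: "'h \<times> 'm" and r :: "'h \<times> 'n"
    by (intro has_cond_exp_future borel_measurable_times measurable_loss_deviation measurable_noise_entry
        loss_noise_uncorrelated) auto
  then have "has_cond_exp M (info p M X v k)
      (\<lambda>\<omega>. \<Sum>q\<in>UNIV. \<Sum>r\<in>UNIV. (K $ q $ r * u \<omega> $ q) * (loss_deviation q \<omega> * noise_entry r \<omega>))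
      (\<lambda>\<omega>. \<Sum>q\<in>UNIV. \<Sum>r\<in>UNIV. (K $ q $ r * u \<omega> $ q) * 0)"
    by (intro F.has_cond_exp_sum F.has_cond_exp_mult borel_measurable_times borel_measurable_vec_nth u) auto
  then show ?thesis by (simp add: inner_matrix_vector_sum mult_ac)
qed

text \<open>A diagonal \<open>\<Psi>\<close> produces only squares of losses, and a 0/1 variable
  equals its square, so the cost is linear in the losses. Off-diagonal weights would bring in
  products of two rates.\<close>

lemma has_cond_exp_input_cost:
  fixes \<Psi> :: "real^('h::{finite,linorder} \<times> 'm)^('h \<times> 'm)"
  assumes u: "u \<in> borel_measurable (info p M X v k)" and diag: "is_diagonal \<Psi>"
  shows "has_cond_exp M (info p M X v k)
    (\<lambda>\<omega>. u \<omega> \<bullet> ((transpose (Upsilon v k \<omega>) ** \<Psi> ** Upsilon v k \<omega>) *v u \<omega>))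
    (\<lambda>\<omega>. \<Sum>q\<in>UNIV. \<Psi> $ q $ q * \<mu> $ snd q * (u \<omega> $ q)\<^sup>2)"
proof -
  interpret F: finite_measure_subalgebra M "info p M X v k" by unfold_locales (rule subalgebra_info)
  have "has_cond_exp M (info p M X v k) (loss_entry q) (\<lambda>_. \<mu> $ snd q)" for q :: "'h \<times> 'm"
    by (intro has_cond_exp_future measurable_loss_entry loss_entry_mean) auto
  then have *: "has_cond_exp M (info p M X v k)
      (\<lambda>\<omega>. \<Sum>q\<in>UNIV. (\<Psi> $ q $ q * (u \<omega> $ q * u \<omega> $ q)) * loss_entry q \<omega>)
      (\<lambda>\<omega>. \<Sum>q\<in>UNIV. (\<Psi> $ q $ q * (u \<omega> $ q * u \<omega> $ q)) * \<mu> $ snd q)"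
    by (intro F.has_cond_exp_sum F.has_cond_exp_mult borel_measurable_times borel_measurable_vec_nth u) auto
  have "u \<omega> \<bullet> ((transpose (Upsilon v k \<omega>) ** \<Psi> ** Upsilon v k \<omega>) *v u \<omega>)
      = (\<Sum>q\<in>UNIV. (\<Psi> $ q $ q * (u \<omega> $ q * u \<omega> $ q)) * loss_entry q \<omega>)" for \<omega>
  proof -
    have "u \<omega> \<bullet> ((transpose (Upsilon v k \<omega>) ** \<Psi> ** Upsilon v k \<omega>) *v u \<omega>)
        = (Upsilon v k \<omega> *v u \<omega>) \<bullet> (diag (\<chi> q. \<Psi> $ q $ q) *v (Upsilon v k \<omega> *v u \<omega>))"
      unfolding is_diagonal_eq[OF diag, symmetric]
      by (simp add: inner_vector_matrix flip: matrix_vector_mul_assoc)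
    also have "\<dots> = (\<Sum>q\<in>UNIV. (\<Psi> $ q $ q * (u \<omega> $ q * u \<omega> $ q)) * loss_entry q \<omega>)"
      unfolding inner_diag Upsilon_eq_diag diag_mult_component vec_lambda_beta loss_entry_def
      by (intro sum.cong refl) (simp split: split_of_bool)
    finally show ?thesis .
  qed
  with * show ?thesis by (simp add: mult_ac power2_eq_square)
qed

text \<open>
  The diagonal of the input weight in the conditional cost after factoring out the loss rates.  Under UDP the
  losses are part of the error, and their variances \<open>\<mu> $ i * (1 - \<mu> $ i)\<close> add a quadratic term in the input.
\<close>

definition penalty :: "real^('h::{finite,linorder} \<times> 'n)^('h \<times> 'n) \<Rightarrow> real^('h \<times> 'm)^('h \<times> 'm) \<Rightarrow> real^('h \<times> 'm)"
  where "penalty \<Omega> \<Psi> = (\<chi> q. \<Psi> $ q $ q + (case p of TCP \<Rightarrow> 0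
    | UDP \<Rightarrow> (transpose (Gamma_mat A B) ** \<Omega> ** Gamma_mat A B) $ q $ q * (1 - \<mu> $ snd q)))"

text \<open>With the error made explicit, the integrand splits into a part known at time
  \<open>k\<close>, a quadratic form in noise and loss deviations, and the input cost. The last two
  average to a constant and to diagonal terms in the input, collected in \<open>penalty\<close> with
  the rates in front.\<close>

lemma cond_cost_eq:
  fixes u :: "'a \<Rightarrow> real^('h::{finite,linorder} \<times> 'm)"
  assumes u: "u \<in> borel_measurable (info p M X v k)"
    and sym: "transpose \<Omega> = \<Omega>" and diag: "is_diagonal \<Psi>"
  shows "AE \<omega> in M. cond_cost p M A B \<mu> Q \<Omega> \<Psi> X W v k u \<omega> =
    X k \<omega> \<bullet> (Q *v X k \<omega>)
    + predicted A B \<mu> (X k \<omega>) (u \<omega>) \<bullet> (\<Omega> *v predicted A B \<mu> (X k \<omega>) (u \<omega>))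
    + trace (kron (mat 1) \<Sigma>W ** (transpose (Lambda_mat A) ** \<Omega> ** Lambda_mat A))
    + u \<omega> \<bullet> (kron (mat 1) (diag \<mu>) *v (diag (penalty \<Omega> \<Psi>) *v u \<omega>))"
proof -
  let ?F = "info p M X v k" and ?\<Gamma> = "Gamma_mat A B" and ?\<Lambda> = "Lambda_mat A"
  let ?K = "transpose ?\<Gamma> ** \<Omega> ** ?\<Gamma>" and ?L = "transpose ?\<Lambda> ** \<Omega> ** ?\<Lambda>"
    and ?C = "transpose ?\<Gamma> ** \<Omega> ** ?\<Lambda>"
  interpret F: finite_measure_subalgebra M ?F by unfold_locales (rule subalgebra_info)
  have leM: "f \<in> borel_measurable ?F \<Longrightarrow> f \<in> borel_measurable M" for f :: "'a \<Rightarrow> real^'e"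
    by (rule measurable_from_subalg[OF subalgebra_info])
  note uM = leM[OF u] and XM = leM[OF measurable_state_info]
  define e where "e \<omega> = (case p of TCP \<Rightarrow> ?\<Lambda> *v stacked_noise \<omega>
      | UDP \<Rightarrow> ?\<Gamma> *v input_deviation u \<omega> + ?\<Lambda> *v stacked_noise \<omega>)" for \<omega>
  have err_e: "AE \<omega> in M. err p M A B X W v k u \<omega> = e \<omega>"
    using err_TCP[OF _ u] err_UDP[OF _ u] by (cases p) (simp_all add: e_def)
  \<comment> \<open>The part of the expected error that depends on the input: none under TCP, the
    loss variances under UDP.\<close>
  define t where "t \<omega> = (\<Sum>q\<in>UNIV. (case p of TCP \<Rightarrow> 0 | UDP \<Rightarrow> ?K $ q $ q * (1 - \<mu> $ snd q))
      * \<mu> $ snd q * (u \<omega> $ q)\<^sup>2)" for \<omega>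
  have noise_part: "has_cond_exp M ?F (\<lambda>\<omega>. e \<omega> \<bullet> (\<Omega> *v e \<omega>))
      (\<lambda>\<omega>. trace (kron (mat 1) \<Sigma>W ** ?L) + t \<omega>)"
  proof -
    have N: "(?\<Lambda> *v x) \<bullet> (\<Omega> *v (?\<Lambda> *v x)) = x \<bullet> (?L *v x)" for x
      by (simp add: inner_vector_matrix flip: matrix_vector_mul_assoc)
    show ?thesis
    proof (cases p)
      case TCP
      then show ?thesis
        using has_cond_exp_noise_quadratic[of ?L] by (simp add: e_def N t_def)
    next
      case UDP
      \<comment> \<open>Symmetry of \<open>\<Omega>\<close> merges the two mixed terms into one,
        whose conditional mean is zero because centred losses and noise are uncorrelated.\<close>
      have Z: "(?\<Gamma> *v z + ?\<Lambda> *v x) \<bullet> (\<Omega> *v (?\<Gamma> *v z + ?\<Lambda> *v x))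
          = x \<bullet> (?L *v x) + (z \<bullet> (?K *v z) + 2 * (z \<bullet> (?C *v x)))" for z x
      proof -
        have "(?\<Lambda> *v x) \<bullet> (\<Omega> *v (?\<Gamma> *v z)) = (?\<Gamma> *v z) \<bullet> (\<Omega> *v (?\<Lambda> *v x))"
          by (metis inner_commute inner_matrix_vector_transpose sym)
        moreover have "(?\<Gamma> *v z) \<bullet> (\<Omega> *v (?\<Gamma> *v z)) = z \<bullet> (?K *v z)"
          "(?\<Gamma> *v z) \<bullet> (\<Omega> *v (?\<Lambda> *v x)) = z \<bullet> (?C *v x)"
          by (simp_all add: inner_vector_matrix flip: matrix_vector_mul_assoc)
        ultimately show ?thesis
          unfolding matrix_vector_right_distrib inner_add_left inner_add_right N by linarith
      qed
      have "has_cond_exp M ?F (\<lambda>\<omega>. stacked_noise \<omega> \<bullet> (?L *v stacked_noise \<omega>)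
          + (input_deviation u \<omega> \<bullet> (?K *v input_deviation u \<omega>)
          + 2 * (input_deviation u \<omega> \<bullet> (?C *v stacked_noise \<omega>))))
        (\<lambda>\<omega>. trace (kron (mat 1) \<Sigma>W ** ?L)
          + ((\<Sum>q\<in>UNIV. ?K $ q $ q * (1 - \<mu> $ snd q) * \<mu> $ snd q * (u \<omega> $ q)\<^sup>2) + 2 * 0))"
        by (intro F.has_cond_exp_add F.has_cond_exp_mult has_cond_exp_noise_quadratic
            has_cond_exp_deviation_quadratic has_cond_exp_deviation_noise u) auto
      then show ?thesis using UDP by (simp add: e_def Z t_def)
    qed
  qed
  define c where "c \<omega> = X k \<omega> \<bullet> (Q *v X k \<omega>)
      + predicted A B \<mu> (X k \<omega>) (u \<omega>) \<bullet> (\<Omega> *v predicted A B \<mu> (X k \<omega>) (u \<omega>))" for \<omega>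
  have c: "c \<in> borel_measurable ?F"
    unfolding c_def[abs_def]
    by (intro borel_measurable_add borel_measurable_inner borel_measurable_matrix_vector_mult
        measurable_predicted measurable_state_info u)
  let ?r = "\<lambda>\<omega>. u \<omega> \<bullet> ((transpose (Upsilon v k \<omega>) ** \<Psi> ** Upsilon v k \<omega>) *v u \<omega>)"
  note r = has_cond_exp_input_cost[OF u diag]
  have total: "has_cond_exp M ?F (\<lambda>\<omega>. c \<omega> + e \<omega> \<bullet> (\<Omega> *v e \<omega>) + ?r \<omega>)
      (\<lambda>\<omega>. c \<omega> + (trace (kron (mat 1) \<Sigma>W ** ?L) + t \<omega>)
        + (\<Sum>q\<in>UNIV. \<Psi> $ q $ q * \<mu> $ snd q * (u \<omega> $ q)\<^sup>2))"
    by (intro F.has_cond_exp_add F.has_cond_exp_F_meas c noise_part r)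
  \<comment> \<open>\<open>err\<close> equals \<open>e\<close> only almost everywhere. Exchanging
    them under a conditional expectation requires both integrands to be measurable, hence also
    \<open>err\<close>, which is itself built from conditional expectations.\<close>
  have "err p M A B X W v k u \<in> borel_measurable M"
  proof -
    have "stacked_state A B X W v k u \<in> borel_measurable M"
      unfolding stacked_state_deviation[abs_def]
      by (intro borel_measurable_add borel_measurable_matrix_vector_mult measurable_predicted XM uM
          measurable_input_deviation measurable_stacked_noise)
    then show ?thesis
      unfolding err_def[abs_def] vec_cond_exp_def
      by (intro borel_measurable_diff borel_measurable_vec_lambda borel_measurable_cond_exp2)
  qed
  then have "(\<lambda>\<omega>. c \<omega> + err p M A B X W v k u \<omega> \<bullet> (\<Omega> *v err p M A B X W v k u \<omega>) + ?r \<omega>) \<in> borel_measurable M"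
    by (intro borel_measurable_add borel_measurable_inner borel_measurable_matrix_vector_mult
        has_cond_exp_measurable[OF r] measurable_from_subalg[OF subalgebra_info c])
  moreover have "AE \<omega> in M. c \<omega> + err p M A B X W v k u \<omega> \<bullet> (\<Omega> *v err p M A B X W v k u \<omega>) + ?r \<omega>
      = c \<omega> + e \<omega> \<bullet> (\<Omega> *v e \<omega>) + ?r \<omega>"
    using err_e by eventually_elim simp
  ultimately have cost: "AE \<omega> in M. cond_cost p M A B \<mu> Q \<Omega> \<Psi> X W v k u \<omega>
      = real_cond_exp M ?F (\<lambda>\<omega>. c \<omega> + e \<omega> \<bullet> (\<Omega> *v e \<omega>) + ?r \<omega>) \<omega>"
    unfolding cond_cost_def c_def by (intro F.real_cond_exp_cong) (use has_cond_exp_measurable[OF total] in \<open>auto simp: c_def\<close>)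
  have tail: "t \<omega> + (\<Sum>q\<in>UNIV. \<Psi> $ q $ q * \<mu> $ snd q * (u \<omega> $ q)\<^sup>2)
      = u \<omega> \<bullet> (kron (mat 1) (diag \<mu>) *v (diag (penalty \<Omega> \<Psi>) *v u \<omega>))" for \<omega>
    unfolding kron_diag_eq_diag inner_diag t_def penalty_def
    by (simp add: diag_mult_component power2_eq_square algebra_simps flip: sum.distrib)
  show ?thesis
    using cost F.has_cond_exp_imp_eq[OF total] by eventually_elim (simp add: c_def tail[symmetric])
qed

end

section \<open>Optimal cost, and the optimal law with its uniqueness almost everywhere\<close>

theorem theorem1:
  fixes M :: "'a measure"
    and p :: protocol
    and A Q \<Sigma>W :: "real^'n^'n"
    and B :: "real^'m^'n"
    and \<mu> :: "real^'m"
    and \<Omega> :: "real^('h::{finite,linorder} \<times> 'n)^('h \<times> 'n)"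
    and \<Psi> :: "real^('h \<times> 'm)^('h \<times> 'm)"
    and X W :: "nat \<Rightarrow> 'a \<Rightarrow> real^'n"
    and v :: "nat \<Rightarrow> 'm \<Rightarrow> 'a \<Rightarrow> bool"
    and U :: "nat \<Rightarrow> 'a \<Rightarrow> real^'m"
    and k :: nat
  assumes prob: "prob_space M"
    and noise: "positive_definite \<Sigma>W" "\<And>j. gaussian M (W j) 0 \<Sigma>W"
    and losses: "\<And>i. 0 \<le> \<mu> $ i \<and> \<mu> $ i \<le> 1" "positive_definite (diag \<mu>)"
      "\<And>j i. bernoulli M (v j i) (\<mu> $ i)"
    and initial: "X 0 \<in> borel_measurable M"
    and indep: "prob_space.indep_sets M (source_events M (X 0) W v) UNIV"
    and past_inputs: "\<And>j. j < k \<Longrightarrow> U j \<in> borel_measurable (info p M X v j)"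
    and plant: "\<And>j \<omega>. j < k \<Longrightarrow> \<omega> \<in> space M \<Longrightarrow>
      X (Suc j) \<omega> = A *v X j \<omega> + B *v (loss_matrix v j \<omega> *v U j \<omega>) + W j \<omega>"
    and state: "\<exists>m \<Sigma>. positive_definite \<Sigma> \<and> gaussian M (X k) m \<Sigma>"
    and weights: "is_diagonal Q" "positive_definite Q" "is_diagonal \<Omega>" "positive_definite \<Omega>"
      "is_diagonal \<Psi>" "positive_definite \<Psi>"
    and Ub: "Ub = (kron (mat 1) (diag \<mu>) :: real^('h \<times> 'm)^('h \<times> 'm))"
    and \<Sigma>WW: "\<Sigma>WW = (kron (mat 1) \<Sigma>W :: real^('h \<times> 'n)^('h \<times> 'n))"
    and \<Omega>p: "\<Omega>p = transpose (Phi_mat A) ** \<Omega> ** Phi_mat A"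
    and \<Omega>g: "\<Omega>g = transpose (Gamma_mat A B) ** \<Omega> ** Gamma_mat A B"
    and \<Omega>gp: "\<Omega>gp = transpose (Gamma_mat A B) ** \<Omega> ** Phi_mat A"
    and \<Omega>l: "\<Omega>l = transpose (Lambda_mat A) ** \<Omega> ** Lambda_mat A"
    and G: "G = (case p of
        TCP \<Rightarrow> \<Omega>g ** Ub + \<Psi>
      | UDP \<Rightarrow> \<Psi> + (mat 1 \<odot> \<Omega>g) ** (mat 1 - Ub) + \<Omega>g ** Ub)"
    and J: "J = cond_cost p M A B \<mu> Q \<Omega> \<Psi> X W v k"
    and Uopt: "Uopt = (\<lambda>\<omega>. - (matrix_inv G *v (\<Omega>gp *v X k \<omega>)))"
  shows "invertible G \<and>
    is_optimal_cost M (info p M X v k) J (\<lambda>\<omega>.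
           X k \<omega> \<bullet> ((Q + \<Omega>p) *v X k \<omega>)
           + trace (\<Sigma>WW ** \<Omega>l)
           - X k \<omega> \<bullet> ((transpose \<Omega>gp ** Ub ** matrix_inv G ** \<Omega>gp) *v X k \<omega>)) \<and>
    is_optimal_input M (info p M X v k) J Uopt \<and>
    (\<forall>u. is_optimal_input M (info p M X v k) J u \<longrightarrow> (AE \<omega> in M. u \<omega> = Uopt \<omega>))"
proof -
  interpret lossy_plant M p A \<Sigma>W B \<mu> X W v U k
    using assms by (intro lossy_plant.intro lossy_plant_axioms.intro) auto
  let ?F = "info p M X v k" and ?\<Phi> = "Phi_mat A :: real^'n^('h \<times> 'n)"
    and ?\<Gamma> = "Gamma_mat A B :: real^('h \<times> 'm)^('h \<times> 'n)"
  define m :: "real^('h \<times> 'm)" where "m = (\<chi> q. \<mu> $ snd q)"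
  have sym: "transpose \<Omega> = \<Omega>" and \<Omega>_nonneg: "0 \<le> y \<bullet> (\<Omega> *v y)" for y
    using weights(4) by (cases "y = 0"; force simp: positive_definite_def less_imp_le)+
  have \<Omega>g_nonneg: "0 \<le> \<Omega>g $ q $ q" for q
  proof -
    have "\<Omega>g $ q $ q = axis q 1 \<bullet> (\<Omega>g *v axis q 1)"
      by (simp add: inner_axis' matrix_vector_mul_component inner_axis)
    also have "\<dots> = (?\<Gamma> *v axis q 1) \<bullet> (\<Omega> *v (?\<Gamma> *v axis q 1))"
      unfolding \<Omega>g by (simp add: inner_vector_matrix flip: matrix_vector_mul_assoc)
    finally show ?thesis using \<Omega>_nonneg by simp
  qed
  have d_pos: "0 < penalty \<Omega> \<Psi> $ q" for q
  proof -
    have "0 < \<Psi> $ q $ q" by (rule positive_definite_diagonal_pos) fact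
    moreover have "0 \<le> \<Omega>g $ q $ q * (1 - \<mu> $ snd q)"
      using \<Omega>g_nonneg[of q] losses(1)[of "snd q"] by simp
    ultimately show ?thesis
      unfolding penalty_def \<Omega>g[symmetric] by (cases p) simp_all
  qed
  have m_pos: "0 < m $ q" for q
    using positive_definite_diagonal_pos[OF losses(2), of "snd q"] by (simp add: m_def diag_def)
  interpret lossy_quadratic \<Omega> ?\<Phi> ?\<Gamma> m "penalty \<Omega> \<Psi>"
    by unfold_locales (fact sym \<Omega>_nonneg m_pos d_pos)+
  have Ub_diag: "Ub = diag m" by (simp add: Ub m_def kron_diag_eq_diag)
  have G_gain: "G = gain"
  proof (cases p)
    case TCP
    have "diag (penalty \<Omega> \<Psi>) = \<Psi>"
      using is_diagonal_eq[OF weights(5)] unfolding penalty_def by (simp add: TCP)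
    then show ?thesis
      unfolding gain_def G Ub_diag \<Omega>g by (simp add: TCP)
  next
    case UDP
    \<comment> \<open>The Hadamard product with the identity keeps only the diagonal, so this
      summand is a product of diagonal matrices and joins \<open>\<Psi>\<close> in
      \<open>penalty\<close>.\<close>
    have "(mat 1 \<odot> \<Omega>g) ** (mat 1 - Ub) = diag (\<chi> q. \<Omega>g $ q $ q * (1 - m $ q))"
    proof -
      have "mat 1 \<odot> \<Omega>g = diag (\<chi> q. \<Omega>g $ q $ q)" "mat 1 - Ub = diag (\<chi> q. 1 - m $ q)"
        by (auto simp: Ub_diag mat_def diag_def vec_eq_iff)
      then show ?thesis by (simp add: diag_mult_diag) (simp add: vec_eq_iff diag_def)
    qed
    moreover have "diag (penalty \<Omega> \<Psi>) = \<Psi> + diag (\<chi> q. \<Omega>g $ q $ q * (1 - m $ q))"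
    proof -
      have "penalty \<Omega> \<Psi> = (\<chi> q. \<Psi> $ q $ q) + (\<chi> q. \<Omega>g $ q $ q * (1 - m $ q))"
        unfolding penalty_def \<Omega>g m_def by (simp add: UDP vec_eq_iff)
      then have "diag (penalty \<Omega> \<Psi>) = diag (\<chi> q. \<Psi> $ q $ q) + diag (\<chi> q. \<Omega>g $ q $ q * (1 - m $ q))"
        by (simp only: diag_add)
      then show ?thesis by (simp only: is_diagonal_eq[OF weights(5), symmetric])
    qed
    ultimately show ?thesis
      unfolding gain_def G Ub_diag \<Omega>g[symmetric] by (simp add: UDP)
  qed
  have coupling: "\<Omega>gp = coupling" by (simp add: \<Omega>gp coupling_def)
  define c where "c \<omega> = X k \<omega> \<bullet> ((Q + \<Omega>p) *v X k \<omega>) + trace (\<Sigma>WW ** \<Omega>l)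
    - X k \<omega> \<bullet> ((transpose \<Omega>gp ** Ub ** matrix_inv G ** \<Omega>gp) *v X k \<omega>)" for \<omega>
  have Uopt_minimiser: "Uopt \<omega> = minimiser (X k \<omega>)" for \<omega>
    by (simp add: Uopt minimiser_def G_gain coupling)
  \<comment> \<open>The excess over \<open>c\<close> is a positive definite form in the distance
    from \<open>Uopt\<close>. Its vanishing at \<open>Uopt\<close> gives the value, its
    nonnegativity the optimality, and its definiteness the uniqueness.\<close>
  have cost: "AE \<omega> in M. J u \<omega> = c \<omega> + bil (u \<omega> - Uopt \<omega>) (u \<omega> - Uopt \<omega>)"
    if u: "u \<in> borel_measurable ?F" for u
    using cond_cost_eq[OF u sym weights(5), of Q]
  proof eventually_elim
    case (elim \<omega>)
    show ?case
      using complete_square[of "X k \<omega>" "u \<omega>"] elim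
      unfolding J c_def Uopt_minimiser predicted_def Ub[symmetric] Ub_diag \<Sigma>WW \<Omega>l \<Omega>p G_gain coupling
      by (simp add: matrix_vector_mult_add_rdistrib inner_add_right)
  qed
  have bil_nonneg: "0 \<le> bil y y" for y
    using bil_pos[of y] by (cases "y = 0") (auto simp: bil_def)
  have Uopt_measurable: "Uopt \<in> borel_measurable ?F"
    unfolding Uopt by (intro borel_measurable_uminus borel_measurable_matrix_vector_mult measurable_state_info)
  have J_Uopt: "AE \<omega> in M. J Uopt \<omega> = c \<omega>"
    using cost[OF Uopt_measurable] by eventually_elim (simp add: bil_def)
  have opt: "is_optimal_input M ?F J Uopt"
    unfolding is_optimal_input_def
  proof (intro conjI ballI Uopt_measurable)
    fix u :: "'a \<Rightarrow> real^('h \<times> 'm)" assume "u \<in> borel_measurable ?F"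
    from cost[OF this] J_Uopt show "AE \<omega> in M. J Uopt \<omega> \<le> J u \<omega>"
      by eventually_elim (simp add: bil_nonneg)
  qed
  moreover have "AE \<omega> in M. u \<omega> = Uopt \<omega>" if u: "is_optimal_input M ?F J u" for u
  proof -
    have "AE \<omega> in M. J u \<omega> \<le> J Uopt \<omega>" "u \<in> borel_measurable ?F"
      using u Uopt_measurable by (auto simp: is_optimal_input_def)
    from this(1) cost[OF this(2)] J_Uopt show ?thesis
    proof eventually_elim
      case (elim \<omega>)
      then have "bil (u \<omega> - Uopt \<omega>) (u \<omega> - Uopt \<omega>) \<le> 0" by simp
      then show ?case using bil_pos[of "u \<omega> - Uopt \<omega>"] by (cases "u \<omega> - Uopt \<omega> = 0") auto
    qed
  qed
  moreover have "is_optimal_cost M ?F J c"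
    unfolding is_optimal_cost_def using opt J_Uopt by (intro exI[of _ Uopt]) (auto elim: eventually_mono)
  ultimately show ?thesis
    using invertible_gain unfolding G_gain c_def by blast
qed

end
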